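(* Let $k\geq 0$ and $m\geq k+1$ be integers, and let $W$ be the Coxeter group of type $B_{m-k}$. For any Coxeter element $c$ of $W$, the multi-cluster complex $\Delta^k_c(W)$ is isomorphic to the simplicial complex $\Delta^{sym}_{m,k}$ of centrally symmetric $k$-triangulations of a regular convex $2m$-gon.
   Context: $\Delta^k_c(W)=\Delta(\mathbf{c}^k\mathbf{w}_\circ(\mathbf{c}),w_\circ)$, where $\mathbf{c}$ is a reduced word of the Coxeter element $c$ (product of all simple generators in some order), $w_\circ$ is the longest element, $\mathbf{w}_\circ(\mathbf{c})$ is the lexicographically first (as a sequence of positions) subword of $\mathbf{c}\mathbf{c}\mathbf{c}\cdots$ which is a reduced expression for $w_\circ$, and for a word $Q$ and $\pi\in W$ the subword complex $\Delta(Q,\pi)$ is the simplicial complex on the positions of $Q$ whose faces are the sets $P$ of positions such that deleting $P$ from $Q$ leaves a word containing a reduced expression for $\pi$ as a subword. Label the vertices of a regular convex $2m$-gon $0,\dots,2m-1$. A diagonal $[i,j]$ is $k$-relevant if there are at least $k$ vertices of the polygon strictly on each side of it. Central symmetry maps $[i,j]$ to $[i+m,j+m]$ (indices mod $2m$); a symmetric pair is an orbit $\{d,\bar d\}$ of a $k$-relevant diagonal under central symmetry (a single diagonal if $d$ is a diameter). A $(k+1)$-crossing is a set of $k+1$ pairwise crossing diagonals. $\Delta^{sym}_{m,k}$ is the simplicial complex whose vertices are the symmetric pairs of $k$-relevant diagonals and whose faces are the collections of such pairs whose diagonals together contain no $(k+1)$-crossing; its facets are the centrally symmetric $k$-triangulations.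 *)

theory Defs
  imports "HOL-Algebra.Generated_Groups" "HOL-Library.Sublist"
begin

section \<open>Abstract simplicial complexes\<close>

text \<open>
  A complex is a pair of its ground set and its set of faces. A ground set element need not be a
  face: for \<open>k = 0\<close> both complexes below have the empty set as their only face.
\<close>

type_synonym 'a scomplex = "'a set \<times> 'a set set"

definition scomplex_iso :: "'a scomplex \<Rightarrow> 'b scomplex \<Rightarrow> bool" where
  "scomplex_iso K L \<longleftrightarrow>
     (\<exists>f. bij_betw f (fst K) (fst L) \<and> (\<forall>F\<subseteq>fst K. F \<in> snd K \<longleftrightarrow> f ` F \<in> snd L))"

section \<open>Coxeter systems\<close>

text \<open>
  Simple generators are a family \<open>s\<close> indexed by a set \<open>I\<close>; a word is a list over \<open>I\<close>.
\<close>

definition word_prod :: "('a, 'b) monoid_scheme \<Rightarrow> ('i \<Rightarrow> 'a) \<Rightarrow> 'i list \<Rightarrow> 'a" where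
  "word_prod G s w = foldr (\<lambda>i x. s i \<otimes>\<^bsub>G\<^esub> x) w \<one>\<^bsub>G\<^esub>"

text \<open>
  The congruence on words generated by the relations \<open>(s\<^sub>i s\<^sub>j)\<^bsup>M i j\<^esup> = 1\<close>. As \<open>M i i = 1\<close> in a
  Coxeter matrix, every letter is its own inverse, so that this presents the Coxeter group and no
  formal inverses are needed. An entry \<open>0\<close> would stand for \<open>\<infinity>\<close>, its relation being trivial.
\<close>

inductive coxeter_equiv :: "'i set \<Rightarrow> ('i \<Rightarrow> 'i \<Rightarrow> nat) \<Rightarrow> 'i list \<Rightarrow> 'i list \<Rightarrow> bool"
  for I :: "'i set" and M :: "'i \<Rightarrow> 'i \<Rightarrow> nat" where
  relation: "\<lbrakk>i \<in> I; j \<in> I\<rbrakk> \<Longrightarrow> coxeter_equiv I M (u @ concat (replicate (M i j) [i, j]) @ v) (u @ v)"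
| refl: "coxeter_equiv I M u u"
| sym: "coxeter_equiv I M u v \<Longrightarrow> coxeter_equiv I M v u"
| trans: "\<lbrakk>coxeter_equiv I M u v; coxeter_equiv I M v w\<rbrakk> \<Longrightarrow> coxeter_equiv I M u w"

definition coxeter_system ::
    "('a, 'b) monoid_scheme \<Rightarrow> 'i set \<Rightarrow> ('i \<Rightarrow> 'a) \<Rightarrow> ('i \<Rightarrow> 'i \<Rightarrow> nat) \<Rightarrow> bool" where
  "coxeter_system G I s M \<longleftrightarrow>
     group G \<and> s ` I \<subseteq> carrier G \<and> generate G (s ` I) = carrier G \<and>
     (\<forall>u\<in>lists I. \<forall>v\<in>lists I. word_prod G s u = word_prod G s v \<longleftrightarrow> coxeter_equiv I M u v)"

text \<open>The diagram is the path \<open>0, 1, 2, \<dots>\<close> whose edge \<open>{0, 1}\<close> is labelled \<open>4\<close>.\<close>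

definition coxeter_matrix_B :: "nat \<Rightarrow> nat \<Rightarrow> nat" where
  "coxeter_matrix_B i j =
     (if i = j then 1
      else if {i, j} = {0, 1} then 4
      else if j = Suc i \<or> i = Suc j then 3
      else 2)"

definition coxeter_length :: "('a, 'b) monoid_scheme \<Rightarrow> 'i set \<Rightarrow> ('i \<Rightarrow> 'a) \<Rightarrow> 'a \<Rightarrow> nat" where
  "coxeter_length G I s x = (LEAST l. \<exists>w\<in>lists I. length w = l \<and> word_prod G s w = x)"

definition reduced_word ::
    "('a, 'b) monoid_scheme \<Rightarrow> 'i set \<Rightarrow> ('i \<Rightarrow> 'a) \<Rightarrow> 'i list \<Rightarrow> 'a \<Rightarrow> bool" where
  "reduced_word G I s w x \<longleftrightarrow>
     w \<in> lists I \<and> word_prod G s w = x \<and> length w = coxeter_length G I s x"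

definition longest_element :: "('a, 'b) monoid_scheme \<Rightarrow> 'i set \<Rightarrow> ('i \<Rightarrow> 'a) \<Rightarrow> 'a" where
  "longest_element G I s =
     (THE x. x \<in> carrier G \<and> (\<forall>y\<in>carrier G. coxeter_length G I s y \<le> coxeter_length G I s x))"

definition coxeter_element :: "('a, 'b) monoid_scheme \<Rightarrow> 'i set \<Rightarrow> ('i \<Rightarrow> 'a) \<Rightarrow> 'a \<Rightarrow> bool" where
  "coxeter_element G I s c \<longleftrightarrow> (\<exists>w. distinct w \<and> set w = I \<and> word_prod G s w = c)"

section \<open>Subword complexes and multi-cluster complexes\<close>

definition subword_complex ::
    "('a, 'b) monoid_scheme \<Rightarrow> 'i set \<Rightarrow> ('i \<Rightarrow> 'a) \<Rightarrow> 'i list \<Rightarrow> 'a \<Rightarrow> nat scomplex" where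
  "subword_complex G I s Q x =
     ({..<length Q},
      {P. P \<subseteq> {..<length Q} \<and> (\<exists>u. subseq u (nths Q (- P)) \<and> reduced_word G I s u x)})"

definition periodic_letter :: "'i list \<Rightarrow> nat \<Rightarrow> 'i" where
  "periodic_letter cw p = cw ! (p mod length cw)"

definition reduced_positions ::
    "('a, 'b) monoid_scheme \<Rightarrow> 'i set \<Rightarrow> ('i \<Rightarrow> 'a) \<Rightarrow> 'i list \<Rightarrow> 'a \<Rightarrow> nat list \<Rightarrow> bool" where
  "reduced_positions G I s cw x ps \<longleftrightarrow>
     sorted_wrt (<) ps \<and> reduced_word G I s (map (periodic_letter cw) ps) x"

definition sorting_word ::
    "('a, 'b) monoid_scheme \<Rightarrow> 'i set \<Rightarrow> ('i \<Rightarrow> 'a) \<Rightarrow> 'i list \<Rightarrow> 'a \<Rightarrow> 'i list" where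
  "sorting_word G I s cw x =
     map (periodic_letter cw)
       (THE ps. reduced_positions G I s cw x ps \<and>
          (\<forall>qs. reduced_positions G I s cw x qs \<longrightarrow> ps = qs \<or> (ps, qs) \<in> lexord less_than))"

definition multi_cluster_complex ::
    "('a, 'b) monoid_scheme \<Rightarrow> 'i set \<Rightarrow> ('i \<Rightarrow> 'a) \<Rightarrow> nat \<Rightarrow> 'i list \<Rightarrow> nat scomplex" where
  "multi_cluster_complex G I s k cw =
     (let w = longest_element G I s
      in subword_complex G I s (concat (replicate k cw) @ sorting_word G I s cw w) w)"

section \<open>Centrally symmetric multi-triangulations\<close>

text \<open>
  The vertices of the \<open>2m\<close>-gon are \<open>0, \<dots>, 2m - 1\<close> in cyclic order and a diagonal is the set of
  its two end points. Boundary edges are not excluded; they have no vertex on one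
  side, hence they are \<open>k\<close>-relevant only if \<open>k = 0\<close>.
\<close>

definition relevant_diagonals :: "nat \<Rightarrow> nat \<Rightarrow> nat set set" where
  "relevant_diagonals m k =
     {{i, j} | i j. i < j \<and> j < 2 * m \<and>
        k \<le> card {i<..<j} \<and> k \<le> card ({..<2 * m} - {i..j})}"

definition central_symmetry :: "nat \<Rightarrow> nat set \<Rightarrow> nat set" where
  "central_symmetry m d = (\<lambda>i. (i + m) mod (2 * m)) ` d"

definition symmetric_pairs :: "nat \<Rightarrow> nat \<Rightarrow> nat set set set" where
  "symmetric_pairs m k = {{d, central_symmetry m d} | d. d \<in> relevant_diagonals m k}"

definition crosses :: "nat set \<Rightarrow> nat set \<Rightarrow> bool" where
  "crosses d e \<longleftrightarrow>
     (\<exists>a b a' b'. a < a' \<and> a' < b \<and> b < b' \<and>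
        (d = {a, b} \<and> e = {a', b'} \<or> d = {a', b'} \<and> e = {a, b}))"

definition is_crossing :: "nat \<Rightarrow> nat set set \<Rightarrow> bool" where
  "is_crossing l X \<longleftrightarrow> finite X \<and> card X = l \<and> pairwise crosses X"

definition symmetric_multitriangulation_complex :: "nat \<Rightarrow> nat \<Rightarrow> nat set set scomplex" where
  "symmetric_multitriangulation_complex m k =
     (symmetric_pairs m k,
      {F. F \<subseteq> symmetric_pairs m k \<and> \<not> (\<exists>X\<subseteq>\<Union>F. is_crossing (k + 1) X)})"

end

theory Submission
  imports Defs "HOL-Library.Product_Plus"
begin

text \<open>
  Let \<open>n = m - k\<close>. Since \<open>c\<^sup>n\<close> is a reduced word of the longest element, the complex in question is the
  subword complex of the word \<open>Q = c\<^sup>m\<close>. Realise \<open>B\<^sub>n\<close> by permutations of \<open>2n\<close> integers. A word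
  contains a reduced word of \<open>w\<^sub>\<circ>\<close> if and only if its Demazure product is \<open>w\<^sub>\<circ>\<close>, that is, if bubble sorting along
  the word reverses the identity. For each threshold \<open>t\<close>, the number \<open>h p\<close> of values \<open>\<le> t\<close> right of the
  wall \<open>p\<close> evolves by \<open>h p := min (h (p - 1)) (h (p + 1) + 1)\<close>, so the final heights are minima of
  costs of lattice paths through the heap of \<open>Q\<close>, where a path goes straight through deleted letters
  and turns left or right at the others. The letters of \<open>Q\<close> correspond to the pairs of relevant
  diagonals in such a way that the letters at which a path goes straight form a chain in the product order on
  the lifted end points of the diagonals. A path is cheap enough to
  prevent the reversal if and only if it goes straight through \<open>k + 1\<close> pairwise crossing diagonals.
\<close>

section \<open>Normal forms of words\<close>

text \<open>The number \<open>k + 1\<close> comes from a count. Acting as the reversal means having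
  height \<open>n - p\<close> at every wall \<open>p\<close> for the threshold \<open>- p\<close>.
  The first slot of the wall \<open>- p\<close> and the point after the last slot of the wall
  \<open>p\<close> are exchanged by the half turn \<open>(x, y) \<mapsto> (y, x + 2m)\<close> of
  lifted diagonals, and they span a rectangle of width \<open>m - p\<close>. A path across it pays
  one unit for each step in the first coordinate, and each straight passage saves one; saving more
  than \<open>m - n = k\<close> units brings the height below \<open>n - p\<close>.

  The abstract group is tied to the permutations at the longest element: rewriting to normal words
  leaves one candidate of length \<open>n * n\<close>, and counting inversions shows that a word
  acting as the reversal has at least that length. That \<open>c^n\<close> is such a word is itself
  an instance of the path criterion, namely \<open>m = n\<close> with no letter deleted.\<close>

lemma coxeter_equiv_context:
  "coxeter_equiv I M u v \<Longrightarrow> coxeter_equiv I M (a @ u @ b) (a @ v @ b)"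
proof (induction rule: coxeter_equiv.induct)
  case (relation i j u v)
  then show ?case
    using coxeter_equiv.relation[of i I j M "a @ u" "v @ b"] by simp
qed (auto intro: coxeter_equiv.intros)

lemmas [trans] = coxeter_equiv.trans

declare upt_Suc [simp del]

context
  fixes n :: nat
begin

abbreviation equiv_B :: "nat list \<Rightarrow> nat list \<Rightarrow> bool" (infix "\<approx>" 50) where
  "u \<approx> v \<equiv> coxeter_equiv {..<n} coxeter_matrix_B u v"

lemma equiv_B_square: "i < n \<Longrightarrow> a @ [i, i] @ b \<approx> a @ b"
  using coxeter_equiv.relation[of i "{..<n}" i coxeter_matrix_B a b]
  by (simp add: coxeter_matrix_B_def)

text \<open>The relator \<open>(ij)^M\<close> followed by the reversal of its second half can be
  shortened in two ways: by the relation, or by cancelling squares from the junction outwards.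
  Comparing the results turns a power relation into a braid relation; the next two lemmas argue
  alike.\<close>

lemma equiv_B_commute:
  assumes "i < n" "j < n" "i \<noteq> j" "i \<noteq> Suc j" "j \<noteq> Suc i"
  shows "a @ [i, j] @ b \<approx> a @ [j, i] @ b"
proof -
  have "coxeter_matrix_B i j = 2"
    using assms by (auto simp: coxeter_matrix_B_def doubleton_eq_iff)
  then have "a @ [i, j, i, j] @ [j, i] @ b \<approx> a @ [j, i] @ b"
    using coxeter_equiv.relation[of i "{..<n}" j coxeter_matrix_B a "[j, i] @ b"] assms
    by (simp add: numeral_eq_Suc)
  moreover have "a @ [i, j, i, j] @ [j, i] @ b \<approx> a @ [i, j] @ b"
    using equiv_B_square[OF assms(2), of "a @ [i, j, i]" "i # b"]
      equiv_B_square[OF assms(1), of "a @ [i, j]" b]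
    by (auto intro: coxeter_equiv.trans)
  ultimately show ?thesis
    by (blast intro: coxeter_equiv.intros)
qed

lemma equiv_B_braid:
  assumes "Suc i < n" "0 < i"
  shows "a @ [Suc i, i, Suc i] @ b \<approx> a @ [i, Suc i, i] @ b"
proof -
  let ?j = "Suc i"
  have "coxeter_matrix_B i ?j = 3"
    using assms by (auto simp: coxeter_matrix_B_def doubleton_eq_iff)
  then have "a @ [i, ?j, i, ?j, i, ?j] @ [?j, i, ?j] @ b \<approx> a @ [?j, i, ?j] @ b"
    using coxeter_equiv.relation[of i "{..<n}" ?j coxeter_matrix_B a "[?j, i, ?j] @ b"] assms
    by (simp add: numeral_eq_Suc)
  moreover have "a @ [i, ?j, i, ?j, i, ?j] @ [?j, i, ?j] @ b \<approx> a @ [i, ?j, i] @ b"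
    using equiv_B_square[of ?j "a @ [i, ?j, i, ?j, i]" "[i, ?j] @ b"]
      equiv_B_square[of i "a @ [i, ?j, i, ?j]" "?j # b"]
      equiv_B_square[of ?j "a @ [i, ?j, i]" "b"] assms
    by (auto intro: coxeter_equiv.trans)
  ultimately show ?thesis
    by (blast intro: coxeter_equiv.intros)
qed

lemma equiv_B_braid4:
  assumes "1 < n"
  shows "a @ [1, 0, 1, 0] @ b \<approx> a @ [0, 1, 0, 1] @ b"
proof -
  have "coxeter_matrix_B 0 1 = 4"
    by (simp add: coxeter_matrix_B_def)
  then have "a @ [0, 1, 0, 1, 0, 1, 0, 1] @ [1, 0, 1, 0] @ b \<approx> a @ [1, 0, 1, 0] @ b"
    using coxeter_equiv.relation[of 0 "{..<n}" 1 coxeter_matrix_B a "[1, 0, 1, 0] @ b"] assms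
    by (simp add: numeral_eq_Suc)
  moreover have "a @ [0, 1, 0, 1, 0, 1, 0, 1] @ [1, 0, 1, 0] @ b \<approx> a @ [0, 1, 0, 1] @ b"
    using equiv_B_square[of 1 "a @ [0, 1, 0, 1, 0, 1, 0]" "[0, 1, 0] @ b"]
      equiv_B_square[of 0 "a @ [0, 1, 0, 1, 0, 1]" "[1, 0] @ b"]
      equiv_B_square[of 1 "a @ [0, 1, 0, 1, 0]" "[0] @ b"]
      equiv_B_square[of 0 "a @ [0, 1, 0, 1]" "b"] assms
    by (auto intro: coxeter_equiv.trans)
  ultimately show ?thesis
    by (blast intro: coxeter_equiv.intros)
qed

lemma equiv_B_commute_word:
  assumes "j < n" "\<And>i. i \<in> set r \<Longrightarrow> i < n \<and> i \<noteq> j \<and> i \<noteq> Suc j \<and> j \<noteq> Suc i"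
  shows "a @ r @ [j] @ b \<approx> a @ [j] @ r @ b"
  using assms(2)
proof (induction r arbitrary: a)
  case Nil
  show ?case by (simp add: coxeter_equiv.refl)
next
  case (Cons i r)
  have "a @ (i # r) @ [j] @ b \<approx> (a @ [i]) @ [j] @ r @ b"
    using Cons.IH[of "a @ [i]"] Cons.prems by simp
  also have "(a @ [i]) @ [j] @ r @ b \<approx> a @ [j] @ (i # r) @ b"
    using equiv_B_commute[of i j a "r @ b"] Cons.prems assms(1) by simp
  finally show ?case .
qed

text \<open>The letter \<open>j\<close> commutes leftwards until it meets \<open>j, j - 1\<close>,
  the braid relation trades it for \<open>j - 1\<close>, and that letter commutes with the rest.
  \<open>2 \<le> j\<close> keeps the braid off the edge \<open>{0, 1}\<close>, whose label is
  4.\<close>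

lemma equiv_B_descending:
  assumes "p < j" "2 \<le> j" "j \<le> i" "i < n"
  shows "a @ rev [p..<Suc i] @ [j] @ b \<approx> a @ [j - 1] @ rev [p..<Suc i] @ b"
proof -
  obtain l where l: "j = Suc l" using assms by (cases j) auto
  define A where "A = rev [Suc j..<Suc i]"
  define B where "B = rev [p..<l]"
  have "[p..<Suc i] = [p..<l] @ [l..<Suc i]"
    using assms l by (metis less_Suc_eq_le upt_add_eq_append le_add_diff_inverse le_trans
        Suc_leD le_SucI)
  also have "[l..<Suc i] = l # j # [Suc j..<Suc i]"
    using assms l by (simp add: upt_conv_Cons)
  finally have r: "rev [p..<Suc i] = A @ [j, l] @ B"
    by (simp add: A_def B_def)
  have "a @ rev [p..<Suc i] @ [j] @ b \<approx> (a @ A @ [j, l]) @ [j] @ B @ b"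
    using equiv_B_commute_word[of j B "a @ A @ [j, l]" b] assms l unfolding r by (simp add: B_def)
  also have "(a @ A @ [j, l]) @ [j] @ B @ b \<approx> a @ A @ [l] @ [j, l] @ B @ b"
    using equiv_B_braid[of l "a @ A" "B @ b"] assms l by simp
  also have "a @ A @ [l] @ [j, l] @ B @ b \<approx> a @ [l] @ A @ [j, l] @ B @ b"
    using equiv_B_commute_word[of l A a "[j, l] @ B @ b"] assms l by (auto simp: A_def)
  finally show ?thesis
    unfolding r by (simp add: l)
qed

lemma equiv_B_ascending:
  assumes "1 \<le> j" "j < q" "q < n"
  shows "a @ [1..<Suc q] @ [j] @ b \<approx> a @ [Suc j] @ [1..<Suc q] @ b"
proof -
  define A where "A = [1..<j]"
  define B where "B = [Suc (Suc j)..<Suc q]"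
  have "[1..<Suc q] = [1..<j] @ [j..<Suc q]"
    using assms by (metis upt_add_eq_append le_add_diff_inverse le_SucI less_imp_le_nat)
  also have "[j..<Suc q] = j # Suc j # B"
    using assms unfolding B_def by (metis upt_conv_Cons Suc_less_eq less_SucI)
  finally have r: "[1..<Suc q] = A @ [j, Suc j] @ B"
    by (simp add: A_def)
  have "a @ [1..<Suc q] @ [j] @ b \<approx> (a @ A @ [j, Suc j]) @ [j] @ B @ b"
    using equiv_B_commute_word[of j B "a @ A @ [j, Suc j]" b] assms unfolding r
    by (simp add: B_def)
  also have "(a @ A @ [j, Suc j]) @ [j] @ B @ b \<approx> a @ A @ [Suc j] @ [j, Suc j] @ B @ b"
    using equiv_B_braid[of j "a @ A" "B @ b"] assms by (simp add: coxeter_equiv.sym)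
  also have "a @ A @ [Suc j] @ [j, Suc j] @ B @ b \<approx> a @ [Suc j] @ A @ [j, Suc j] @ B @ b"
    using equiv_B_commute_word[of "Suc j" A a "[j, Suc j] @ B @ b"] assms by (auto simp: A_def)
  finally show ?thesis
    unfolding r by simp
qed

end

text \<open>
  The minimal coset representatives of \<open>B\<^sub>i\<close> in \<open>B\<^sub>i\<^sub>+\<^sub>1\<close> are the prefixes of the word
  \<open>i, \<dots>, 1, 0, 1, \<dots>, i\<close>.
\<close>

definition coset_words :: "nat \<Rightarrow> nat list set" where
  "coset_words i = {rev [p..<Suc i] | p. 1 \<le> p \<and> p \<le> Suc i} \<union>
     {rev [0..<Suc i] @ [1..<Suc q] | q. q \<le> i}"

fun normal_words :: "nat \<Rightarrow> nat list set" where
  "normal_words 0 = {[]}"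
| "normal_words (Suc i) = {a @ r | a r. a \<in> normal_words i \<and> r \<in> coset_words i}"

text \<open>The longest coset representative at every level, hence
  \<open>1 + 3 + \<dots> + (2i - 1) = i * i\<close> letters.\<close>

fun longest_normal_word :: "nat \<Rightarrow> nat list" where
  "longest_normal_word 0 = []"
| "longest_normal_word (Suc i) = longest_normal_word i @ rev [0..<Suc i] @ [1..<Suc i]"

text \<open>Deodhar's lemma for this chain of parabolic subgroups: a generator multiplied to the
  right of a representative either yields another representative or passes through to the left as a
  generator of the smaller subgroup.\<close>

lemma coset_words_step:
  assumes r: "r \<in> coset_words i" and j: "j \<le> i" and i: "i < n"
  shows "(\<exists>r'\<in>coset_words i. \<forall>a. equiv_B n (a @ r @ [j]) (a @ r')) \<or>
    (\<exists>j'<i. \<forall>a. equiv_B n (a @ r @ [j]) (a @ [j'] @ r))"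
proof -
  consider (down) p where "1 \<le> p" "p \<le> Suc i" "r = rev [p..<Suc i]"
    | (up) q where "q \<le> i" "r = rev [0..<Suc i] @ [1..<Suc q]"
    using r unfolding coset_words_def by blast
  then show ?thesis
  proof cases
    case down
    consider "j = p" | "Suc j = p" | "Suc j < p" | "p < j" by linarith
    then show ?thesis
    proof cases
      case 1
      then have "r @ [j] = rev [Suc p..<Suc i] @ [p, p]"
        using down j by (simp add: upt_conv_Cons)
      then have "\<forall>a. equiv_B n (a @ r @ [j]) (a @ rev [Suc p..<Suc i])"
        using equiv_B_square[of p n _ "[]"] 1 j i by (metis append.right_neutral append.assoc le_less_trans)
      moreover have "rev [Suc p..<Suc i] \<in> coset_words i"
        unfolding coset_words_def using 1 j by (auto intro!: exI[of _ "Suc p"])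
      ultimately show ?thesis by blast
    next
      case 2
      then have e: "r @ [j] = rev [j..<Suc i]"
        using down j by (simp add: upt_conv_Cons)
      have "r @ [j] \<in> coset_words i"
      proof (cases "j = 0")
        case True
        then show ?thesis unfolding coset_words_def e by (intro UnI2) (auto intro!: exI[of _ 0])
      next
        case False
        then show ?thesis unfolding coset_words_def e using j by (intro UnI1) (auto intro!: exI[of _ j])
      qed
      then show ?thesis by (metis coxeter_equiv.refl)
    next
      case 3
      have "\<forall>a. equiv_B n (a @ r @ [j]) (a @ [j] @ r)"
        using equiv_B_commute_word[of j n r _ "[]"] 3 down i by auto
      then show ?thesis using 3 down by (metis Suc_less_SucD less_le_trans)
    next
      case 4
      then have "\<forall>a. equiv_B n (a @ r @ [j]) (a @ [j - 1] @ r)"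
        using equiv_B_descending[of p j i n _ "[]"] down j i by auto
      moreover have "j - 1 < i" using 4 j by linarith
      ultimately show ?thesis by blast
    qed
  next
    case up
    consider "j = Suc q" | "j = q" "q = 0" | "j = q" "0 < q" | "Suc q < j"
      | "1 \<le> j" "j < q" | "j = 0" "0 < q" by linarith
    then show ?thesis
    proof cases
      case 1
      then have "r @ [j] = rev [0..<Suc i] @ [1..<Suc (Suc q)]" by (simp add: up upt_Suc)
      then have "r @ [j] \<in> coset_words i"
        unfolding coset_words_def using 1 j by blast
      then show ?thesis by (metis coxeter_equiv.refl)
    next
      case 2
      then have "r @ [j] = rev [1..<Suc i] @ [0, 0]"
        using up by (simp add: upt_rec[of 0])
      then have "\<forall>a. equiv_B n (a @ r @ [j]) (a @ rev [1..<Suc i])"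
        using equiv_B_square[of 0 n _ "[]"] i by (metis append.right_neutral append.assoc gr_zeroI not_less0)
      moreover have "rev [1..<Suc i] \<in> coset_words i"
        unfolding coset_words_def by (intro UnI1) (auto intro!: exI[of _ 1])
      ultimately show ?thesis by blast
    next
      case 3
      then obtain l where l: "q = Suc l" by (cases q) auto
      then have "r @ [j] = (rev [0..<Suc i] @ [1..<Suc l]) @ [q, q]"
        using up 3 by (simp add: upt_Suc)
      then have "\<forall>a. equiv_B n (a @ r @ [j]) (a @ rev [0..<Suc i] @ [1..<Suc l])"
        using equiv_B_square[of q n _ "[]"] up i by (metis append.right_neutral append.assoc le_less_trans)
      moreover have "rev [0..<Suc i] @ [1..<Suc l] \<in> coset_words i"
        unfolding coset_words_def using up l by (intro UnI2) auto
      ultimately show ?thesis by blast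
    next
      case 4
      have "equiv_B n (a @ r @ [j]) (a @ [j - 1] @ r)" for a
      proof -
        have "equiv_B n (a @ r @ [j]) ((a @ rev [0..<Suc i]) @ [j] @ [1..<Suc q])"
          using equiv_B_commute_word[of j n "[1..<Suc q]" "a @ rev [0..<Suc i]" "[]"] 4 up j i
          by auto
        also have "equiv_B n ((a @ rev [0..<Suc i]) @ [j] @ [1..<Suc q]) (a @ [j - 1] @ r)"
          using equiv_B_descending[of 0 j i n a "[1..<Suc q]"] 4 up j i by auto
        finally show ?thesis .
      qed
      moreover have "j - 1 < i" using 4 j by linarith
      ultimately show ?thesis by blast
    next
      case 5
      \<comment> \<open>The ascending run raises the index by one and the descending run lowers it
        again.\<close>
      have "equiv_B n (a @ r @ [j]) (a @ [j] @ r)" for a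
      proof -
        have "equiv_B n (a @ r @ [j]) ((a @ rev [0..<Suc i]) @ [Suc j] @ [1..<Suc q])"
          using equiv_B_ascending[of j q n "a @ rev [0..<Suc i]" "[]"] 5 up j i
          by auto
        also have "equiv_B n ((a @ rev [0..<Suc i]) @ [Suc j] @ [1..<Suc q]) (a @ [j] @ r)"
          using equiv_B_descending[of 0 "Suc j" i n a "[1..<Suc q]"] 5 up j i by auto
        finally show ?thesis .
      qed
      moreover have "j < i" using 5 up by linarith
      ultimately show ?thesis by blast
    next
      case 6
      define A where "A = rev [2..<Suc i]"
      define B where "B = [2..<Suc q]"
      have d: "rev [0..<Suc i] = A @ [1, 0]"
        using 6 up by (simp add: A_def upt_conv_Cons numeral_2_eq_2)
      have u: "[1..<Suc q] = [1] @ B"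
        using 6 by (simp add: B_def upt_conv_Cons numeral_2_eq_2)
      \<comment> \<open>The label 4 enters here: \<open>1, 0, 1, 0 = 0, 1, 0, 1\<close> carries the
        letter 0 past the turning point of the run.\<close>
      have "equiv_B n (a @ r @ [j]) (a @ [0] @ r)" for a
      proof -
        have "equiv_B n (a @ r @ [j]) ((a @ A @ [1, 0, 1]) @ [0] @ B)"
          using equiv_B_commute_word[of 0 n B "a @ A @ [1, 0, 1]" "[]"] 6 up i
          unfolding up(2) d u by (auto simp: B_def)
        also have "equiv_B n ((a @ A @ [1, 0, 1]) @ [0] @ B) (a @ A @ [0] @ [1, 0, 1] @ B)"
          using equiv_B_braid4[of n "a @ A" B] 6 up i by simp
        also have "equiv_B n (a @ A @ [0] @ [1, 0, 1] @ B) (a @ [0] @ A @ [1, 0, 1] @ B)"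
          using equiv_B_commute_word[of 0 n A a "[1, 0, 1] @ B"] i by (auto simp: A_def)
        finally show ?thesis
          unfolding up(2) d u by simp
      qed
      moreover have "0 < i" using 6 up by linarith
      ultimately show ?thesis by blast
    qed
  qed
qed

lemma normal_words_step:
  "w \<in> normal_words i \<Longrightarrow> j < i \<Longrightarrow> i \<le> n \<Longrightarrow> \<exists>w'\<in>normal_words i. equiv_B n (w @ [j]) w'"
proof (induction i arbitrary: w j)
  case (Suc i)
  obtain a r where w: "w = a @ r" "a \<in> normal_words i" "r \<in> coset_words i"
    using Suc.prems by auto
  consider r' where "r' \<in> coset_words i" "equiv_B n (a @ r @ [j]) (a @ r')"
    | j' where "j' < i" "equiv_B n (a @ r @ [j]) (a @ [j'] @ r)"
    using coset_words_step[OF w(3), of j n] Suc.prems by fastforce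
  then show ?case
  proof cases
    case 1
    then show ?thesis using w by auto
  next
    case 2
    obtain a' where a': "a' \<in> normal_words i" "equiv_B n (a @ [j']) a'"
      using Suc.IH[OF w(2) 2(1)] Suc.prems by auto
    have "equiv_B n (a @ [j'] @ r) (a' @ r)"
      using coxeter_equiv_context[OF a'(2), of "[]" r] by simp
    then have "equiv_B n (w @ [j]) (a' @ r)"
      using 2(2) w(1) by (auto intro: coxeter_equiv.trans)
    then show ?thesis using a'(1) w(3) by auto
  qed
qed simp

lemma equiv_normal_word:
  "w \<in> lists {..<n} \<Longrightarrow> \<exists>w'\<in>normal_words n. equiv_B n w w'"
proof (induction w rule: rev_induct)
  case Nil
  have "[] \<in> normal_words i" for i
  proof (induction i)
    case (Suc i)
    have "[] \<in> coset_words i" unfolding coset_words_def by (auto intro!: exI[of _ "Suc i"])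
    then show ?case using Suc by auto
  qed simp
  then show ?case by (blast intro: coxeter_equiv.refl)
next
  case (snoc j w)
  then obtain w' where w': "w' \<in> normal_words n" "equiv_B n w w'" by auto
  obtain w'' where "w'' \<in> normal_words n" "equiv_B n (w' @ [j]) w''"
    using normal_words_step[OF w'(1), of j n] snoc.prems by auto
  moreover have "equiv_B n (w @ [j]) (w' @ [j])"
    using coxeter_equiv_context[OF w'(2), of "[]" "[j]"] by simp
  ultimately show ?case by (blast intro: coxeter_equiv.trans)
qed

lemma normal_words_length:
  "w \<in> normal_words i \<Longrightarrow> length w \<le> i * i \<and> (length w = i * i \<longrightarrow> w = longest_normal_word i)"
proof (induction i arbitrary: w)
  case (Suc i)
  obtain a r where w: "w = a @ r" "a \<in> normal_words i" "r \<in> coset_words i"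
    using Suc.prems by auto
  have "length r \<le> 2 * i + 1 \<and> (length r = 2 * i + 1 \<longrightarrow> r = rev [0..<Suc i] @ [1..<Suc i])"
    using w(3) unfolding coset_words_def by auto
  moreover have "Suc i * Suc i = i * i + (2 * i + 1)" by simp
  ultimately show ?case using Suc.IH[OF w(2)] w(1) by auto
qed simp

lemma normal_words_lists: "w \<in> normal_words i \<Longrightarrow> w \<in> lists {..<i}"
proof (induction i arbitrary: w)
  case (Suc i)
  then show ?case by (fastforce simp: coset_words_def)
qed simp

section \<open>Signed permutations\<close>

text \<open>
  \<open>B\<^sub>n\<close> acts on the \<open>2n\<close> integers in \<open>{1 - n..n}\<close> by the permutations commuting with \<open>q \<mapsto> 1 - q\<close>.
  The wall \<open>p\<close> separates \<open>p\<close> from \<open>p + 1\<close>, and the generator \<open>i\<close> swaps across the walls \<open>i\<close> and \<open>- i\<close>.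
\<close>

definition refl_B :: "nat \<Rightarrow> int \<Rightarrow> int" where
  "refl_B i q =
     (if q = int i then q + 1 else if q = int i + 1 then q - 1
      else if q = - int i then q + 1 else if q = 1 - int i then q - 1 else q)"

definition perm_B :: "nat list \<Rightarrow> int \<Rightarrow> int" where
  "perm_B u = foldr (\<lambda>i f. refl_B i \<circ> f) u id"

lemma perm_B_Nil [simp]: "perm_B [] = id"
  by (simp add: perm_B_def)

lemma perm_B_Cons [simp]: "perm_B (i # u) = refl_B i \<circ> perm_B u"
  by (simp add: perm_B_def)

lemma perm_B_append [simp]: "perm_B (u @ v) = perm_B u \<circ> perm_B v"
  by (induction u) (simp_all add: comp_assoc)

lemma refl_B_refl_B [simp]: "refl_B i (refl_B i q) = q"
  by (simp add: refl_B_def)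

lemma refl_B_sym: "refl_B i (1 - q) = 1 - refl_B i q"
  by (simp add: refl_B_def)

lemma refl_B_greater: "\<bar>p\<bar> \<noteq> int i \<Longrightarrow> refl_B i q > p \<longleftrightarrow> q > p"
  by (auto simp: refl_B_def)

lemma refl_B_commute:
  "i \<noteq> j \<Longrightarrow> i \<noteq> Suc j \<Longrightarrow> j \<noteq> Suc i \<Longrightarrow> refl_B i (refl_B j q) = refl_B j (refl_B i q)"
  by (simp add: refl_B_def)

lemma refl_B_braid:
  "0 < i \<Longrightarrow> refl_B i (refl_B (Suc i) (refl_B i q)) = refl_B (Suc i) (refl_B i (refl_B (Suc i) q))"
  by (simp add: refl_B_def)

lemma refl_B_braid4:
  "refl_B 0 (refl_B 1 (refl_B 0 (refl_B 1 q))) = refl_B 1 (refl_B 0 (refl_B 1 (refl_B 0 q)))"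
  by (simp add: refl_B_def)

lemma perm_B_relation: "perm_B (concat (replicate (coxeter_matrix_B i j) [i, j])) = id"
proof -
  consider "i = j" | "i = 0 \<and> j = 1 \<or> i = 1 \<and> j = 0" | "0 < i" "j = Suc i" | "0 < j" "i = Suc j"
    | "i \<noteq> j" "i \<noteq> Suc j" "j \<noteq> Suc i" by linarith
  then show ?thesis
  proof cases
    case 1
    then show ?thesis by (auto simp: coxeter_matrix_B_def fun_eq_iff)
  next
    case 2
    then have "coxeter_matrix_B i j = 4" by (auto simp: coxeter_matrix_B_def)
    then show ?thesis using 2 refl_B_braid4
      by (auto simp: fun_eq_iff numeral_eq_Suc)
  next
    case 3
    then have "coxeter_matrix_B i j = 3" by (auto simp: coxeter_matrix_B_def doubleton_eq_iff)
    then show ?thesis using refl_B_braid[OF 3(1)] 3(2)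
      by (auto simp: fun_eq_iff numeral_eq_Suc)
  next
    case 4
    then have "coxeter_matrix_B i j = 3" by (auto simp: coxeter_matrix_B_def doubleton_eq_iff)
    then show ?thesis using refl_B_braid[OF 4(1)] 4(2)
      by (auto simp: fun_eq_iff numeral_eq_Suc)
  next
    case 5
    then have "coxeter_matrix_B i j = 2" by (auto simp: coxeter_matrix_B_def doubleton_eq_iff)
    then show ?thesis using refl_B_commute[OF 5]
      by (auto simp: fun_eq_iff numeral_eq_Suc)
  qed
qed

lemma perm_B_cong: "coxeter_equiv I coxeter_matrix_B u v \<Longrightarrow> perm_B u = perm_B v"
  by (induction rule: coxeter_equiv.induct) (simp_all add: perm_B_relation)

lemma perm_B_greater: "i \<notin> set u \<Longrightarrow> \<bar>p\<bar> = int i \<Longrightarrow> perm_B u q > p \<longleftrightarrow> q > p"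
  by (induction u arbitrary: q) (auto simp: refl_B_greater)

text \<open>A word without \<open>i\<close> moves no point across the wall \<open>i\<close>, whereas
  a word with a single \<open>i\<close> does: the point lifted by that letter cannot return.
  Consequently every reduced word of a Coxeter element uses all letters.\<close>

lemma letter_mem_if_perm_B_eq:
  assumes "distinct w" "i \<in> set w" "perm_B u = perm_B w"
  shows "i \<in> set u"
proof (rule ccontr)
  assume "i \<notin> set u"
  then have *: "perm_B w q > int i \<longleftrightarrow> q > int i" for q
    unfolding assms(3)[symmetric] using perm_B_greater[of i u "int i" q] by simp
  obtain a b where w: "w = a @ i # b" using assms(2) by (meson split_list)
  then have ab: "i \<notin> set a" "i \<notin> set b" using assms(1) by auto
  have "bij (perm_B v)" for v
  proof (induction v)
    case (Cons j v)
    have "bij (refl_B j)" by (rule o_bij[of "refl_B j"]) (auto simp: fun_eq_iff)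
    then show ?case using Cons bij_comp by (metis perm_B_Cons)
  qed (simp del: id_apply)
  then obtain q where q: "perm_B b q = int i" by (metis bij_is_surj surjD)
  have "\<not> q > int i" using perm_B_greater[of i b "int i" q] ab q by simp
  moreover have "perm_B w q > int i"
    using perm_B_greater[of i a "int i" "int i + 1"] ab q by (simp add: w refl_B_def)
  ultimately show False using * by blast
qed

section \<open>Inversions of signed permutations and a lower bound for word lengths\<close>

definition sym_perm :: "nat \<Rightarrow> (int \<Rightarrow> int) \<Rightarrow> bool" where
  "sym_perm n x \<longleftrightarrow> inj x \<and> (\<forall>q. x (1 - q) = 1 - x q) \<and> (\<forall>q. q \<notin> {1 - int n..int n} \<longrightarrow> x q = q)"

definition opposite :: "nat \<Rightarrow> int \<Rightarrow> int" where
  "opposite n q = (if q \<in> {1 - int n..int n} then 1 - q else q)"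

lemma sym_perm_id: "sym_perm n id"
  by (simp add: sym_perm_def)

lemma sym_perm_refl_B: "sym_perm n x \<Longrightarrow> i < n \<Longrightarrow> sym_perm n (x \<circ> refl_B i)"
proof -
  assume x: "sym_perm n x" and i: "i < n"
  have "inj (refl_B i)" by (metis injI refl_B_refl_B)
  moreover have "refl_B i q = q" if "q \<notin> {1 - int n..int n}" for q
    using that i by (auto simp: refl_B_def)
  ultimately show ?thesis using x
    by (simp add: sym_perm_def refl_B_sym inj_compose)
qed

text \<open>Twice the Coxeter length.\<close>

definition inv_pairs :: "nat \<Rightarrow> (int \<times> int) set" where
  "inv_pairs n = {(a, b). 1 - int n \<le> a \<and> a < b \<and> b \<le> int n}"

definition inv_count :: "nat \<Rightarrow> (int \<Rightarrow> int) \<Rightarrow> int" where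
  "inv_count n x = (\<Sum>(a, b)\<in>inv_pairs n. of_bool (x a > x b)) + (\<Sum>b\<in>{1..int n}. of_bool (x b \<le> 0))"

lemma finite_inv_pairs [simp]: "finite (inv_pairs n)"
  by (rule finite_subset[of _ "{1 - int n..int n} \<times> {1 - int n..int n}"]) (auto simp: inv_pairs_def)

lemma sum_inv_pairs_refl_B:
  assumes "i < n"
  defines "E \<equiv> {(int i, int i + 1), (- int i, 1 - int i)}"
  shows "(\<Sum>(a, b)\<in>inv_pairs n - E. f (refl_B i a) (refl_B i b)) = (\<Sum>(a, b)\<in>inv_pairs n - E. f a b)"
proof -
  have "(refl_B i a, refl_B i b) \<in> inv_pairs n - E" if "(a, b) \<in> inv_pairs n - E" for a b
    using that assms(1) unfolding inv_pairs_def E_def refl_B_def by (auto split: if_splits)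
  then show ?thesis
    by (intro sum.reindex_bij_witness[of _ "map_prod (refl_B i) (refl_B i)" "map_prod (refl_B i) (refl_B i)"])
      auto
qed

text \<open>All pairs except those across the walls \<open>i\<close> and \<open>- i\<close> are
  merely permuted. For \<open>i > 0\<close> both walls gain an inversion. For \<open>i = 0\<close>
  they coincide, and the second sum of \<open>inv_count\<close>, which counts the inverted pairs
  \<open>(1 - b, b)\<close> once more, supplies the missing unit.\<close>

lemma inv_count_ascent:
  assumes x: "sym_perm n x" and i: "i < n" and asc: "x (int i) < x (int i + 1)"
  shows "inv_count n (x \<circ> refl_B i) = inv_count n x + 2"
proof -
  define E where "E = {(int i, int i + 1), (- int i, 1 - int i)}"
  have E: "E \<subseteq> inv_pairs n" using i by (auto simp: E_def inv_pairs_def)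
  have split: "(\<Sum>(a, b)\<in>inv_pairs n. f a b) = (\<Sum>(a, b)\<in>inv_pairs n - E. f a b) + (\<Sum>(a, b)\<in>E. f a b)"
    for f :: "int \<Rightarrow> int \<Rightarrow> int"
    by (rule sum.subset_diff[OF E]) simp
  have rest: "(\<Sum>(a, b)\<in>inv_pairs n - E. of_bool ((x \<circ> refl_B i) a > (x \<circ> refl_B i) b)) =
      (\<Sum>(a, b)\<in>inv_pairs n - E. of_bool (x a > x b) :: int)"
    using sum_inv_pairs_refl_B[OF i, of "\<lambda>a b. of_bool (x a > x b) :: int"] by (simp add: E_def)
  have sym: "x (1 - q) = 1 - x q" for q using x by (simp add: sym_perm_def)
  have asc': "x (- int i) < x (1 - int i)"
    using asc sym[of "int i"] sym[of "int i + 1"] by simp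
  have r: "refl_B i (int i) = int i + 1" "refl_B i (int i + 1) = int i"
    "refl_B i (- int i) = 1 - int i" "refl_B i (1 - int i) = - int i"
    by (auto simp: refl_B_def)
  show ?thesis
  proof (cases "i = 0")
    case True
    have "x 0 = 1 - x 1" using sym[of 1] by simp
    moreover have "refl_B 0 b = b" if "b \<in> {1..int n} - {1}" for b
      using that by (auto simp: refl_B_def)
    ultimately have "(\<Sum>b\<in>{1..int n} - {1}. of_bool ((x \<circ> refl_B i) b \<le> 0)) =
        (\<Sum>b\<in>{1..int n} - {1}. of_bool (x b \<le> 0) :: int)"
      unfolding True by (intro sum.cong) (metis comp_apply)+
    then have "(\<Sum>b\<in>{1..int n}. of_bool ((x \<circ> refl_B i) b \<le> 0)) =
        (\<Sum>b\<in>{1..int n}. of_bool (x b \<le> 0)) + (1 :: int)"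
      using asc r True i \<open>x 0 = 1 - x 1\<close>
      by (subst (1 2) sum.remove[of _ 1]) simp_all
    moreover have "E = {(0, 1)}" using True by (simp add: E_def)
    ultimately show ?thesis
      unfolding inv_count_def split rest using asc r True by simp
  next
    case False
    have "(\<Sum>b\<in>{1..int n}. of_bool ((x \<circ> refl_B i) b \<le> 0)) = (\<Sum>b\<in>{1..int n}. of_bool (x b \<le> 0) :: int)"
    proof (rule sum.reindex_bij_witness[of _ "refl_B i" "refl_B i"])
      fix b assume "b \<in> {1..int n}"
      then show "refl_B i b \<in> {1..int n}"
        using False i by (auto simp: refl_B_def)
      then show "refl_B i b \<in> {1..int n}" .
    qed auto
    moreover have "(int i, int i + 1) \<noteq> (- int i, 1 - int i)" using False by simp
    then have "(\<Sum>(a, b)\<in>E. f a b) = f (int i) (int i + 1) + f (- int i) (1 - int i)"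
      for f :: "int \<Rightarrow> int \<Rightarrow> int"
      unfolding E_def by (subst sum.insert) auto
    ultimately show ?thesis
      unfolding inv_count_def split rest using asc asc' r by simp
  qed
qed

lemma inv_count_step:
  assumes x: "sym_perm n x" and i: "i < n"
  shows "inv_count n (x \<circ> refl_B i) \<le> inv_count n x + 2"
proof (cases "x (int i) < x (int i + 1)")
  case True
  then show ?thesis using inv_count_ascent[OF x i] by simp
next
  case False
  have "inj x" using x by (simp add: sym_perm_def)
  then have "x (int i) \<noteq> x (int i + 1)" by (simp add: inj_eq)
  then have "(x \<circ> refl_B i) (int i) < (x \<circ> refl_B i) (int i + 1)"
    using False by (simp add: refl_B_def)
  from inv_count_ascent[OF sym_perm_refl_B[OF x i] i this]
  show ?thesis by (simp add: comp_assoc comp_def)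
qed

lemma inv_count_id: "inv_count n id = 0"
  unfolding inv_count_def by (auto simp: inv_pairs_def intro!: sum.neutral)

lemma inv_count_opposite: "inv_count n (opposite n) = 2 * int (n * n)"
proof -
  have swap: "inv_pairs n = prod.swap ` (SIGMA b:{1 - int n..int n}. {1 - int n..<b})"
    by (force simp: inv_pairs_def)
  have "(\<Sum>(a, b)\<in>inv_pairs n. of_bool (opposite n a > opposite n b)) = (\<Sum>(a, b)\<in>inv_pairs n. 1 :: int)"
    by (rule sum.cong) (auto simp: inv_pairs_def opposite_def)
  also have "\<dots> = (\<Sum>b\<in>{1 - int n..int n}. \<Sum>a\<in>{1 - int n..<b}. 1)"
    unfolding swap by (subst sum.reindex) (auto simp: sum.Sigma split_def)
  also have "\<dots> = (\<Sum>b\<in>{1 - int n..int n}. b - (1 - int n))"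
    by (rule sum.cong) auto
  also have "\<dots> = (\<Sum>j\<in>{..<2 * n}. int j)"
    by (rule sum.reindex_bij_witness[of _ "\<lambda>j. int j + 1 - int n" "\<lambda>b. nat (b - (1 - int n))"]) auto
  also have "\<dots> = int n * (2 * int n - 1)"
  proof (induction n)
    case (Suc n)
    have "2 * Suc n = Suc (Suc (2 * n))" by simp
    then show ?case using Suc by (simp only: sum.lessThan_Suc) (simp add: algebra_simps)
  qed simp
  finally have 1: "(\<Sum>(a, b)\<in>inv_pairs n. of_bool (opposite n a > opposite n b)) = int n * (2 * int n - 1)" .
  have "(\<Sum>b\<in>{1..int n}. of_bool (opposite n b \<le> 0)) = (\<Sum>b\<in>{1..int n}. 1 :: int)"
    by (rule sum.cong) (auto simp: opposite_def)
  then show ?thesis unfolding inv_count_def 1 by (simp add: algebra_simps)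
qed

lemma inv_count_perm_B:
  "sym_perm n x \<Longrightarrow> u \<in> lists {..<n} \<Longrightarrow> inv_count n (x \<circ> perm_B u) \<le> inv_count n x + 2 * int (length u)"
proof (induction u arbitrary: x)
  case (Cons i u)
  then have "inv_count n (x \<circ> perm_B (i # u)) \<le> inv_count n (x \<circ> refl_B i) + 2 * int (length u)"
    using Cons.IH[of "x \<circ> refl_B i"] sym_perm_refl_B[of n x i] by (simp add: comp_assoc[symmetric] del: comp_apply)
  then show ?case
    using inv_count_step[of n x i] Cons.prems by (simp del: comp_apply)
qed simp

lemma length_ge_if_opposite:
  assumes "u \<in> lists {..<n}" "perm_B u = opposite n"
  shows "n * n \<le> length u"
proof -
  have "2 * int (n * n) \<le> 2 * int (length u)"
    using inv_count_perm_B[OF sym_perm_id assms(1)] unfolding assms(2) id_comp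
    by (simp only: inv_count_id inv_count_opposite add_0)
  then show ?thesis by linarith
qed

section \<open>Demazure products and heights\<close>

definition demazure_step :: "(int \<Rightarrow> int) \<Rightarrow> nat \<Rightarrow> int \<Rightarrow> int" where
  "demazure_step x i = (if x (int i) < x (int i + 1) then x \<circ> refl_B i else x)"

lemma sym_perm_demazure_step: "sym_perm n x \<Longrightarrow> i < n \<Longrightarrow> sym_perm n (demazure_step x i)"
  by (simp add: demazure_step_def sym_perm_refl_B)

lemma sym_perm_demazure:
  "sym_perm n x \<Longrightarrow> v \<in> lists {..<n} \<Longrightarrow> sym_perm n (foldl demazure_step x v)"
  by (induction v arbitrary: x) (auto simp: sym_perm_demazure_step)

text \<open>The letters that swap form \<open>u\<close>; as each of them adds 2 to
  \<open>inv_count\<close>, the length of \<open>u\<close> can be read off the final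
  permutation.\<close>

lemma demazure_subword:
  "sym_perm n x \<Longrightarrow> v \<in> lists {..<n} \<Longrightarrow>
    \<exists>u. subseq u v \<and> x \<circ> perm_B u = foldl demazure_step x v \<and>
      inv_count n (foldl demazure_step x v) = inv_count n x + 2 * int (length u)"
proof (induction v arbitrary: x)
  case Nil
  show ?case by (intro exI[of _ "[]"]) auto
next
  case (Cons i v)
  obtain u where u: "subseq u v" "demazure_step x i \<circ> perm_B u = foldl demazure_step x (i # v)"
      "inv_count n (foldl demazure_step x (i # v)) = inv_count n (demazure_step x i) + 2 * int (length u)"
    using Cons.IH[OF sym_perm_demazure_step[OF Cons.prems(1), of i]] Cons.prems(2) by (auto simp del: comp_apply)
  show ?case
  proof (cases "x (int i) < x (int i + 1)")
    case True
    then show ?thesis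
      using u Cons.prems inv_count_ascent[OF Cons.prems(1) _ True]
      by (intro exI[of _ "i # u"]) (auto simp: demazure_step_def[of x i] comp_assoc simp del: comp_apply)
  next
    case False
    then show ?thesis
      using u by (intro exI[of _ u]) (auto simp: demazure_step_def[of x i] simp del: comp_apply)
  qed
qed

section \<open>Heights, and how they recognise the reversal\<close>

definition height :: "nat \<Rightarrow> int \<Rightarrow> (int \<Rightarrow> int) \<Rightarrow> int \<Rightarrow> int" where
  "height n t x p = (\<Sum>q\<in>{p<..int n}. of_bool (x q \<le> t))"

definition height_step :: "(int \<Rightarrow> int) \<Rightarrow> nat \<Rightarrow> int \<Rightarrow> int" where
  "height_step h i p = (if \<bar>p\<bar> = int i then min (h (p - 1)) (h (p + 1) + 1) else h p)"

lemma height_rec: "p \<le> int n \<Longrightarrow> height n t x (p - 1) = height n t x p + of_bool (x p \<le> t)"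
proof -
  assume "p \<le> int n"
  then have "{p - 1<..int n} = insert p {p<..int n}" by auto
  then show ?thesis by (simp add: height_def)
qed

lemma height_refl_B_other:
  assumes "i < n" "\<bar>p\<bar> \<noteq> int i"
  shows "height n t (x \<circ> refl_B i) p = height n t x p"
proof -
  have "refl_B i q \<le> int n \<longleftrightarrow> q \<le> int n" for q
    using refl_B_greater[of "int n" i q] assms(1) by linarith
  then have "refl_B i q \<in> {p<..int n} \<longleftrightarrow> q \<in> {p<..int n}" for q
    using refl_B_greater[OF assms(2)] by simp
  then show ?thesis unfolding height_def
    by (intro sum.reindex_bij_witness[of _ "refl_B i" "refl_B i"]) auto
qed

lemma height_refl_B_wall:
  assumes "i < n" "\<bar>p\<bar> = int i"
  shows "height n t (x \<circ> refl_B i) p = height n t x (p + 1) + of_bool (x p \<le> t)"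
proof -
  have "height n t (x \<circ> refl_B i) p = height n t (x \<circ> refl_B i) (p + 1) + of_bool (x p \<le> t)"
  proof -
    have "refl_B i (p + 1) = p" using assms(2) by (auto simp: refl_B_def)
    then show ?thesis using height_rec[of "p + 1" n t "x \<circ> refl_B i"] assms by simp
  qed
  also have "height n t (x \<circ> refl_B i) (p + 1) = height n t x (p + 1)"
  proof (cases "\<bar>p + 1\<bar> = int i")
    case True
    then show ?thesis using assms by (auto simp: abs_if split: if_splits)
  next
    case False
    then show ?thesis using height_refl_B_other assms by blast
  qed
  finally show ?thesis .
qed

lemma height_refl_B_le:
  assumes "i < n"
  shows "height n t (x \<circ> refl_B i) p \<le> height_step (height n t x) i p"
proof (cases "\<bar>p\<bar> = int i")
  case True
  then have "p \<le> int n" "p + 1 \<le> int n" using assms by auto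
  then show ?thesis
    using height_refl_B_wall[OF assms True, of t x] height_rec[of p n t x] height_rec[of "p + 1" n t x] True
    by (auto simp: height_step_def)
next
  case False
  then show ?thesis using height_refl_B_other[OF assms False] by (simp add: height_step_def)
qed

lemma height_le_height_step:
  assumes "i < n"
  shows "height n t x p \<le> height_step (height n t x) i p"
proof (cases "\<bar>p\<bar> = int i")
  case True
  then have "p \<le> int n" "p + 1 \<le> int n" using assms by auto
  then show ?thesis
    using height_rec[of p n t x] height_rec[of "p + 1" n t x]
    by (auto simp: height_step_def)
qed (simp add: height_step_def)

text \<open>\<open>h (p - 1)\<close> exceeds \<open>h (p + 1)\<close> by the number of values at
  \<open>p\<close> and \<open>p + 1\<close> that are at most \<open>t\<close>. After the step the
  smaller value is on the right of the wall, so the new height is \<open>h (p + 1)\<close>, plus one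
  if that number is positive; the minimum computes just this.\<close>

lemma height_demazure_step:
  assumes "sym_perm n x" "i < n"
  shows "height n t (demazure_step x i) = height_step (height n t x) i"
proof
  fix p
  have sym: "x (1 - q) = 1 - x q" for q using assms by (simp add: sym_perm_def)
  show "height n t (demazure_step x i) p = height_step (height n t x) i p"
  proof (cases "\<bar>p\<bar> = int i")
    case True
    then have "p \<le> int n" "p + 1 \<le> int n" using assms by auto
    note rec = height_rec[OF this(1), of t x] height_rec[OF this(2), of t x]
    \<comment> \<open>By symmetry an ascent at the wall \<open>i\<close> is one at
      \<open>- i\<close>, so the single test in \<open>demazure_step\<close> serves both
      walls.\<close>
    have asc: "x (int i) < x (int i + 1) \<longleftrightarrow> x p < x (p + 1)"
    proof (cases "p < 0")
      case False
      then show ?thesis using True by simp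
    next
      case neg: True
      then have "int i = - p" using True by simp
      then show ?thesis using sym[of "- p"] sym[of "1 - p"] by (auto simp: algebra_simps)
    qed
    show ?thesis
      using height_refl_B_wall[OF assms(2) True, of t x] rec True asc
      by (auto simp: height_step_def demazure_step_def)
  next
    case False
    then show ?thesis using height_refl_B_other[OF assms(2) False]
      by (simp add: height_step_def demazure_step_def)
  qed
qed

lemma height_demazure:
  "sym_perm n x \<Longrightarrow> v \<in> lists {..<n} \<Longrightarrow>
    height n t (foldl demazure_step x v) = foldl height_step (height n t x) v"
  by (induction v arbitrary: x) (auto simp: height_demazure_step sym_perm_demazure_step)

lemma height_step_mono: "(\<And>p. g p \<le> h p) \<Longrightarrow> height_step g i p \<le> height_step h i p"
  unfolding height_step_def by (smt (verit))

lemma height_le_foldl_height_step: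
  "v \<in> lists {..<n} \<Longrightarrow> (\<And>p. height n t x p \<le> h p) \<Longrightarrow> height n t x p \<le> foldl height_step h v p"
proof (induction v arbitrary: h)
  case (Cons i v)
  have "height n t x p \<le> height_step h i p" for p
    using height_le_height_step[of i n t x p] height_step_mono[of "height n t x" h i p, OF Cons.prems(2)] Cons.prems(1)
    by auto
  then show ?case using Cons.IH[of "height_step h i"] Cons.prems by auto
qed simp

text \<open>Whether a letter is used or skipped, the height stays below \<open>height_step\<close>,
  which is monotone. So a subword acting as the reversal forces the heights computed along the whole
  word to be at least those of the reversal.\<close>

lemma height_subword_le:
  assumes "subseq u v" "v \<in> lists {..<n}" "\<And>p. height n t x p \<le> h p"
  shows "height n t (x \<circ> perm_B u) p \<le> foldl height_step h v p"
  using assms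
proof (induction u v arbitrary: x h rule: list_emb.induct)
  case (list_emb_Nil v)
  then show ?case using height_le_foldl_height_step by simp
next
  case (list_emb_Cons u v i)
  have "height n t x p \<le> height_step h i p" for p
    using height_le_height_step[of i n t x p] height_step_mono[of "height n t x" h i p, OF list_emb_Cons.prems(2)] list_emb_Cons.prems(1)
    by auto
  then show ?case using list_emb_Cons.IH[of x "height_step h i"] list_emb_Cons.prems by auto
next
  case (list_emb_Cons2 i j u v)
  have "height n t (x \<circ> refl_B i) p \<le> height_step h i p" for p
    using height_refl_B_le[of i n t x p] height_step_mono[of "height n t x" h i p, OF list_emb_Cons2.prems(2)] list_emb_Cons2
    by auto
  then show ?case
    using list_emb_Cons2.IH[of "x \<circ> refl_B i" "height_step h i"] list_emb_Cons2
    by (auto simp: comp_assoc simp del: comp_apply)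
qed

lemma height_opposite:
  assumes "\<bar>p\<bar> \<le> int n"
  shows "height n (- p) (opposite n) p = int n - p"
proof -
  have "height n (- p) (opposite n) p = (\<Sum>q\<in>{p<..int n}. 1)"
    unfolding height_def using assms by (intro sum.cong) (auto simp: opposite_def)
  then show ?thesis using assms by simp
qed

text \<open>Height \<open>n - p\<close> means that all values right of \<open>p\<close> are at most
  \<open>- p\<close>. Seen from the wall \<open>q - 1\<close>, the value at \<open>q\<close> is thus
  at most \<open>1 - q\<close>, and symmetry gives the opposite bound. Each end of the window lacks
  one of these bounds and takes it from the range.\<close>

lemma opposite_if_heights:
  assumes x: "sym_perm n x" and h: "\<And>p. \<bar>p\<bar> < int n \<Longrightarrow> int n - p \<le> height n (- p) x p"
  shows "x = opposite n"
proof
  fix q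
  have sym: "x (1 - q) = 1 - x q" for q using x by (simp add: sym_perm_def)
  have le: "x q \<le> 1 - q" if q: "q \<in> {2 - int n..int n}" for q
  proof (rule ccontr)
    assume "\<not> x q \<le> 1 - q"
    then have "height n (1 - q) x (q - 1) = height n (1 - q) x q"
      using height_rec[of q n "1 - q" x] q by simp
    also have "\<dots> \<le> (\<Sum>q'\<in>{q<..int n}. 1)"
      unfolding height_def by (rule sum_mono) simp
    also have "\<dots> = int n - q" using q by simp
    finally have "height n (1 - q) x (q - 1) \<le> int n - q" .
    moreover have "\<bar>q - 1\<bar> < int n" using q by auto
    from h[OF this] have "int n - (q - 1) \<le> height n (1 - q) x (q - 1)" by simp
    ultimately show False by simp
  qed
  have ge: "1 - q \<le> x q" if "q \<in> {1 - int n..int n - 1}" for q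
    using le[of "1 - q"] sym[of q] that by auto
  have range: "x q \<in> {1 - int n..int n}" if "q \<in> {1 - int n..int n}" for q
    using x that unfolding sym_perm_def by (metis injD)
  show "x q = opposite n q"
  proof (cases "q \<in> {1 - int n..int n}")
    case True
    then have "x q \<le> 1 - q" "1 - q \<le> x q"
      using le[of q] range[of q] ge[of q] by (cases "q = 1 - int n"; cases "q = int n"; force)+
    then show ?thesis using True by (simp add: opposite_def)
  next
    case False
    then show ?thesis using x unfolding sym_perm_def opposite_def by metis
  qed
qed

section \<open>Slots\<close>

locale coxeter_word =
  fixes n :: nat and cw :: "nat list"
  assumes length_cw: "length cw = n" and set_cw: "set cw = {..<n}"
begin

definition pos :: "nat \<Rightarrow> nat" where
  "pos i = (LEAST l. cw ! l = i)"

text \<open>This encodes the orientation of the Coxeter diagram by \<open>c\<close>; the coordinates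
  of slots depend on \<open>c\<close> through it alone. Its extension \<open>shift\<close> satisfies
  \<open>shift (- p) = shift p + p\<close>, which makes the two coordinates of a slot differ by
  \<open>m + p\<close>.\<close>

fun shift_nat :: "nat \<Rightarrow> int" where
  "shift_nat 0 = 0"
| "shift_nat (Suc i) = shift_nat i - of_bool (pos (Suc i) < pos i)"

definition shift :: "int \<Rightarrow> int" where
  "shift p = (if 0 \<le> p then shift_nat (nat p) else shift_nat (nat (- p)) - p)"

lemma pos_nth: "l < n \<Longrightarrow> pos (cw ! l) = l"
proof -
  assume l: "l < n"
  have "distinct cw" by (rule card_distinct) (simp add: length_cw set_cw)
  moreover have "cw ! pos (cw ! l) = cw ! l" "pos (cw ! l) \<le> l"
    unfolding pos_def by (rule LeastI[of _ l], simp) (rule Least_le, simp)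
  ultimately show ?thesis using l length_cw by (simp add: nth_eq_iff_index_eq)
qed

lemma nth_less: "l < n \<Longrightarrow> cw ! l < n"
  using length_cw set_cw nth_mem by blast

lemma pos_less: "i < n \<Longrightarrow> pos i < n" and nth_pos: "i < n \<Longrightarrow> cw ! pos i = i"
proof -
  assume "i < n"
  then obtain l where "l < n" "cw ! l = i" using set_cw length_cw by (metis in_set_conv_nth lessThan_iff)
  then show "pos i < n" "cw ! pos i = i" using pos_nth by auto
qed

lemma shift_minus: "shift (- p) = shift p + p"
  by (auto simp: shift_def)

lemma shift_Suc:
  assumes "\<bar>p\<bar> < int n" "\<bar>p + 1\<bar> < int n"
  shows "shift (p + 1) = shift p - of_bool (pos (nat \<bar>p + 1\<bar>) < pos (nat \<bar>p\<bar>))"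
proof (cases "0 \<le> p")
  case True
  then have "nat (p + 1) = Suc (nat p)" by simp
  then show ?thesis using True by (simp add: shift_def)
next
  case False
  define i where "i = nat (- p - 1)"
  have p: "p = - int (Suc i)" using False by (simp add: i_def)
  have "pos i \<noteq> pos (Suc i)"
    using nth_pos[of i] nth_pos[of "Suc i"] assms p by (metis abs_minus_cancel abs_of_nat n_not_Suc_n
        of_nat_less_iff Suc_lessD)
  then show ?thesis unfolding p by (auto simp: shift_def nat_add_distrib)
qed

lemma shift_Suc_bounds: "shift (p + 1) \<le> shift p \<and> shift p \<le> shift (p + 1) + 1"
proof (cases "0 \<le> p")
  case True
  then have "nat (p + 1) = Suc (nat p)" by simp
  then show ?thesis using True by (simp add: shift_def)
next
  case False
  define i where "i = nat (- p - 1)"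
  have p: "p = - int (Suc i)" using False by (simp add: i_def)
  show ?thesis unfolding p by (auto simp: shift_def nat_add_distrib)
qed

lemma shift_bounds: "p \<le> q \<Longrightarrow> shift q \<le> shift p \<and> shift p \<le> shift q + (q - p)"
proof (induction q rule: int_ge_induct)
  case (step q)
  then show ?case using shift_Suc_bounds[of q] by linarith
qed simp

lemma shift_antimono: "p \<le> q \<Longrightarrow> shift q \<le> shift p"
  using shift_bounds by blast

definition Q :: "nat \<Rightarrow> nat list" where
  "Q m = concat (replicate m cw)"

lemma length_Q: "length (Q m) = n * m"
  by (induction m) (simp_all add: Q_def length_cw)

lemma nth_Q: "j < n * m \<Longrightarrow> Q m ! j = cw ! (j mod n)"
proof (induction m arbitrary: j)
  case (Suc m)
  show ?case
  proof (cases "j < n")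
    case True
    then show ?thesis by (simp add: Q_def nth_append length_cw)
  next
    case False
    then have "Q (Suc m) ! j = Q m ! (j - n)" by (simp add: Q_def nth_append length_cw)
    also have "\<dots> = cw ! (j mod n)" using Suc.IH[of "j - n"] Suc.prems False by (simp add: le_mod_geq)
    finally show ?thesis .
  qed
qed simp

lemma Q_lists: "Q m \<in> lists {..<n}"
  by (induction m) (auto simp: Q_def set_cw)

text \<open>The number of times the letter \<open>i\<close> occurs among the first \<open>j\<close> letters.\<close>

definition rounds :: "nat \<Rightarrow> nat \<Rightarrow> int" where
  "rounds j i = int (j div n) + of_bool (pos i < j mod n)"

lemma rounds_0 [simp]: "rounds 0 i = 0"
  by (simp add: rounds_def)

lemma rounds_end: "0 < n \<Longrightarrow> rounds (n * m) i = int m"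
  by (simp add: rounds_def)

lemma rounds_Suc:
  assumes "i < n"
  shows "rounds (Suc j) i = rounds j i + of_bool (cw ! (j mod n) = i)"
proof -
  have "j mod n < n" using assms by simp
  then have eq: "cw ! (j mod n) = i \<longleftrightarrow> pos i = j mod n"
    using pos_nth[of "j mod n"] nth_pos[OF assms] by auto
  show ?thesis
  proof (cases "Suc (j mod n) = n")
    case True
    then have "Suc j mod n = 0" "Suc j div n = Suc (j div n)"
      by (simp_all add: mod_Suc div_Suc)
    then show ?thesis using eq pos_less[OF assms] True by (auto simp: rounds_def)
  next
    case False
    then have "Suc j mod n = Suc (j mod n)" "Suc j div n = j div n"
      by (simp_all add: mod_Suc div_Suc)
    then show ?thesis using eq by (auto simp: rounds_def)
  qed
qed

lemma rounds_letter: "0 < n \<Longrightarrow> rounds j (cw ! (j mod n)) = int (j div n)"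
  by (simp add: rounds_def pos_nth)

lemma rounds_neighbour:
  "0 < n \<Longrightarrow> rounds j i = int (j div n) + of_bool (pos i < pos (cw ! (j mod n)))"
  by (simp add: rounds_def pos_nth)

text \<open>
  Diagonals of the \<open>2m\<close>-gon are lifted to pairs \<open>x < y < x + 2m\<close> of integers, the lifts of one
  diagonal being the orbit of \<open>(x, y) \<mapsto> (y, x + 2m)\<close>. The occurrence of a letter in round \<open>r\<close> acts
  on the walls \<open>p = \<plusminus> i\<close>; it is placed at the pair of length \<open>m + p\<close> below, where \<open>shift\<close> is chosen
  such that the occurrences adjacent to it in the heap of the word are at \<open>(x \<plusminus> 1, y)\<close> and \<open>(x, y \<plusminus> 1)\<close>.
\<close>

definition slot :: "nat \<Rightarrow> int \<Rightarrow> int \<Rightarrow> int \<times> int" where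
  "slot m p r = (r + shift p, r + int m + shift (- p))"

definition slots :: "nat \<Rightarrow> nat set \<Rightarrow> (int \<times> int) set" where
  "slots m P = {slot m p (int (j div n)) | j p. j \<in> P \<and> j < n * m \<and> \<bar>p\<bar> = int (cw ! (j mod n))}"

lemma slot_eq_iff: "slot m p r = slot m p' r' \<longleftrightarrow> p = p' \<and> r = r'"
proof
  assume "slot m p r = slot m p' r'"
  then have eq: "r + shift p = r' + shift p'" "r + (shift p + p) = r' + (shift p' + p')"
    by (auto simp: slot_def shift_minus)
  then have "p = p'" by linarith
  then show "p = p' \<and> r = r'" using eq(1) by simp
qed simp

lemma slot_in_slots_iff:
  assumes "\<bar>p\<bar> = int (cw ! (j mod n))" "j < n * m"
  shows "slot m p (int (j div n)) \<in> slots m P \<longleftrightarrow> j \<in> P"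
proof
  assume "slot m p (int (j div n)) \<in> slots m P"
  then obtain j' where j': "j' \<in> P" "j' < n * m" "\<bar>p\<bar> = int (cw ! (j' mod n))" "j' div n = j div n"
    unfolding slots_def by (auto simp: slot_eq_iff)
  have "0 < n" using assms(2) by (cases n) auto
  then have "pos (cw ! (j mod n)) = j mod n" "pos (cw ! (j' mod n)) = j' mod n"
    by (simp_all add: pos_nth)
  moreover have "cw ! (j mod n) = cw ! (j' mod n)" using j'(3) assms(1) by linarith
  ultimately have "j' mod n = j mod n" by metis
  then have "j' = j" using j'(4) div_mult_mod_eq[of j n] div_mult_mod_eq[of j' n] by simp
  then show "j \<in> P" using j' by simp
qed (use assms in \<open>auto simp: slots_def\<close>)

section \<open>Heights along the word, indexed by slots\<close>

definition heights :: "nat \<Rightarrow> nat set \<Rightarrow> (int \<Rightarrow> int) \<Rightarrow> nat \<Rightarrow> int \<Rightarrow> int" where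
  "heights m P h j = foldl height_step h (nths (take j (Q m)) (- P))"

lemma heights_0 [simp]: "heights m P h 0 = h"
  by (simp add: heights_def)

lemma heights_Suc:
  assumes "j < n * m"
  shows "heights m P h (Suc j) =
    (if j \<in> P then heights m P h j else height_step (heights m P h j) (cw ! (j mod n)))"
proof -
  have "take (Suc j) (Q m) = take j (Q m) @ [cw ! (j mod n)]"
    using assms by (simp add: take_Suc_conv_app_nth length_Q nth_Q)
  moreover have "length (take j (Q m)) = j" using assms by (simp add: length_Q)
  ultimately show ?thesis
    by (simp add: heights_def nths_append nths_singleton)
qed

lemma heights_boundary:
  assumes "j \<le> n * m" "\<bar>p\<bar> \<ge> int n"
  shows "heights m P h j p = h p"
  using assms
proof (induction j)
  case (Suc j)
  then have "cw ! (j mod n) < n" by (intro nth_less) (cases n; simp)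
  then show ?case using Suc by (auto simp: heights_Suc height_step_def)
qed simp

text \<open>The slope conditions survive because the walls \<open>p\<close> and \<open>p + 1\<close>
  never belong to the same letter. They say that a letter never lowers a height; so the height kept
  at a deleted slot is bounded by the one that the letter would have produced.\<close>

lemma heights_valid:
  assumes "\<And>p. \<bar>p\<bar> < int n \<Longrightarrow> h p \<le> h (p - 1) \<and> h p \<le> h (p + 1) + 1" "h (int n) \<le> h (int n - 1)" "h (- int n) \<le> h (1 - int n) + 1"
    "j \<le> n * m" "\<bar>p\<bar> < int n"
  shows "heights m P h j p \<le> heights m P h j (p - 1) \<and> heights m P h j p \<le> heights m P h j (p + 1) + 1"
proof -
  have "(\<forall>p. - int n < p \<and> p \<le> int n \<longrightarrow> heights m P h j p \<le> heights m P h j (p - 1)) \<and>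
    (\<forall>p. - int n \<le> p \<and> p < int n \<longrightarrow> heights m P h j p \<le> heights m P h j (p + 1) + 1)"
    using assms(4)
  proof (induction j)
    case 0
    have "h p \<le> h (p - 1)" if "- int n < p" "p \<le> int n" for p
      using assms(1)[of p] assms(2) that by (cases "p = int n") auto
    moreover have "h p \<le> h (p + 1) + 1" if "- int n \<le> p" "p < int n" for p
      using assms(1)[of p] assms(3) that by (cases "p = - int n") auto
    ultimately show ?case by simp
  next
    case (Suc j)
    define g where "g = heights m P h j"
    define i where "i = cw ! (j mod n)"
    have i: "i < n" unfolding i_def using Suc.prems by (intro nth_less) (cases n; simp)
    have g: "\<And>p. - int n < p \<and> p \<le> int n \<longrightarrow> g p \<le> g (p - 1)"
        "\<And>p. - int n \<le> p \<and> p < int n \<longrightarrow> g p \<le> g (p + 1) + 1"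
      using Suc by (auto simp: g_def)
    have up: "g p \<le> height_step g i p" for p
      using g(1)[of p] g(2)[of p] i by (auto simp: height_step_def)
    have a: "height_step g i p \<le> height_step g i (p - 1)" if "- int n < p \<and> p \<le> int n" for p
    proof (cases "\<bar>p\<bar> = int i")
      case True
      then have "\<bar>p - 1\<bar> \<noteq> int i" by linarith
      then show ?thesis using True by (simp add: height_step_def)
    next
      case False
      then have "height_step g i p = g p" by (simp add: height_step_def)
      then show ?thesis using up[of "p - 1"] g(1)[of p] that by simp
    qed
    have b: "height_step g i p \<le> height_step g i (p + 1) + 1" if "- int n \<le> p \<and> p < int n" for p
    proof (cases "\<bar>p\<bar> = int i")
      case True
      then have "\<bar>p + 1\<bar> \<noteq> int i" by linarith
      then show ?thesis using True by (simp add: height_step_def)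
    next
      case False
      then have "height_step g i p = g p" by (simp add: height_step_def)
      then show ?thesis using up[of "p + 1"] g(2)[of p] that by fastforce
    qed
    have "heights m P h (Suc j) = (if j \<in> P then g else height_step g i)"
      using Suc.prems by (simp add: heights_Suc g_def i_def)
    then show ?case using g a b by auto
  qed
  moreover have "- int n < p \<and> p \<le> int n" "- int n \<le> p \<and> p < int n" using assms(5) by auto
  ultimately show ?thesis by blast
qed

text \<open>Whether a neighbouring letter has already occurred in the current round changes the
  round of its next slot by one, and \<open>shift\<close> absorbs this unit.\<close>

lemma slot_neighbours:
  assumes "\<bar>p\<bar> = int (cw ! (j mod n))" "j < n * m"
  shows "\<bar>p + 1\<bar> < int n \<Longrightarrow> slot m (p + 1) (rounds j (nat \<bar>p + 1\<bar>)) =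
      slot m p (int (j div n)) + (0, 1)" (is "_ \<Longrightarrow> ?up")
    and "\<bar>p - 1\<bar> < int n \<Longrightarrow> slot m (p - 1) (rounds j (nat \<bar>p - 1\<bar>)) =
      slot m p (int (j div n)) + (1, 0)" (is "_ \<Longrightarrow> ?down")
proof -
  have n: "0 < n" using assms(2) by (cases n) auto
  then have p: "\<bar>p\<bar> < int n" using nth_less[of "j mod n"] assms(1) by simp
  have ab: "nat \<bar>p\<bar> = cw ! (j mod n)" using assms(1) by simp
  {
    assume "\<bar>p + 1\<bar> < int n"
    then show ?up
      using shift_Suc[of p] p shift_minus[of p] shift_minus[of "p + 1"]
      by (simp add: slot_def rounds_neighbour[OF n] ab)
  next
    assume q: "\<bar>p - 1\<bar> < int n"
    have "nat \<bar>p - 1\<bar> \<noteq> nat \<bar>p\<bar>" by linarith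
    then have "pos (nat \<bar>p - 1\<bar>) \<noteq> pos (nat \<bar>p\<bar>)"
      using nth_pos[of "nat \<bar>p - 1\<bar>"] nth_pos[of "nat \<bar>p\<bar>"] p q
      by (metis nat_less_iff abs_ge_zero)
    then show ?down
      using shift_Suc[of "p - 1"] p q shift_minus[of p] shift_minus[of "p - 1"]
      by (auto simp: slot_def rounds_neighbour[OF n] ab)
  }
qed

text \<open>Induction over the word becomes induction over the plane: \<open>R\<close> relates the
  next slot of each wall to the current height there. It serves twice, with lattice paths to extract
  a chain from a low height, and with an upper bound to derive a low height from a chain.\<close>

lemma heights_invariant:
  fixes R :: "int \<times> int \<Rightarrow> int \<Rightarrow> bool"
  assumes valid: "\<And>p. \<bar>p\<bar> < int n \<Longrightarrow> h p \<le> h (p - 1) \<and> h p \<le> h (p + 1) + 1"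
      "h (int n) \<le> h (int n - 1)" "h (- int n) \<le> h (1 - int n) + 1"
    and init: "\<And>p. \<bar>p\<bar> < int n \<Longrightarrow> R (slot m p 0) (h p)"
    and boundary: "\<And>p r. \<bar>p\<bar> = int n \<Longrightarrow> R (slot m p r) (h p)"
    and step: "\<And>z v l u. \<exists>q r. z = slot m q r \<and> 0 \<le> r \<Longrightarrow> R z v \<Longrightarrow> R (z + (1, 0)) l \<Longrightarrow> R (z + (0, 1)) u \<Longrightarrow> v \<le> l \<Longrightarrow> v \<le> u + 1 \<Longrightarrow>
        R (z + (1, 1)) (if z \<in> slots m P then v else min l (u + 1))"
    and j: "j \<le> n * m" and p: "\<bar>p\<bar> < int n"
  shows "R (slot m p (rounds j (nat \<bar>p\<bar>))) (heights m P h j p)"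
  using j p
proof (induction j arbitrary: p)
  case 0
  then show ?case using init by simp
next
  case (Suc j)
  define g where "g = heights m P h j"
  define i where "i = cw ! (j mod n)"
  have j: "j < n * m" using Suc.prems by simp
  have IH: "R (slot m q (rounds j (nat \<bar>q\<bar>))) (g q)" if "\<bar>q\<bar> < int n" for q
    using Suc that by (simp add: g_def)
  have gb: "g q = h q" if "\<bar>q\<bar> = int n" for q
    using heights_boundary[of j m q P h] j that by (simp add: g_def)
  have pn: "nat \<bar>p\<bar> < n" using Suc.prems by simp
  note hs = heights_Suc[OF j, of P h, folded g_def i_def]
  show ?case
  proof (cases "\<bar>p\<bar> = int i")
    case False
    then have "i \<noteq> nat \<bar>p\<bar>" by auto
    then have "rounds (Suc j) (nat \<bar>p\<bar>) = rounds j (nat \<bar>p\<bar>)"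
      using rounds_Suc[OF pn, of j] by (simp add: i_def)
    moreover have "heights m P h (Suc j) p = g p"
      using False by (simp add: hs height_step_def)
    ultimately show ?thesis using IH[of p] Suc.prems by simp
  next
    case True
    then have ip: "nat \<bar>p\<bar> = i" by simp
    have n: "0 < n" using j by (cases n) auto
    define r where "r = int (j div n)"
    have r: "rounds j i = r" using rounds_letter[OF n, of j] by (simp add: r_def i_def)
    have r': "rounds (Suc j) i = r + 1"
      using rounds_Suc[of i j] pn ip r by (simp add: i_def)
    have pi: "\<bar>p\<bar> = int (cw ! (j mod n))" using True by (simp add: i_def)
    note nb = slot_neighbours[OF pi j, folded r_def]
    define z where "z = slot m p r"
    have "R z (g p)" using IH[of p] Suc.prems ip r by (simp add: z_def)
    moreover have "R (z + (1, 0)) (g (p - 1))"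
    proof (cases "\<bar>p - 1\<bar> < int n")
      case True
      then show ?thesis using IH[OF True] nb(2)[OF True] by (simp add: z_def)
    next
      case False
      \<comment> \<open>The walls \<open>n\<close> and \<open>- n\<close> carry no letter; the
        neighbouring point is a slot there of whatever round fits, which is why
        \<open>boundary\<close> ranges over all \<open>r\<close>.\<close>
      then have "\<bar>p - 1\<bar> = int n" using Suc.prems(2) by linarith
      moreover have "z + (1, 0) = slot m (p - 1) (r + 1 + shift p - shift (p - 1))"
        using shift_minus[of p] shift_minus[of "p - 1"] by (simp add: z_def slot_def)
      ultimately show ?thesis using boundary gb by simp
    qed
    moreover have "R (z + (0, 1)) (g (p + 1))"
    proof (cases "\<bar>p + 1\<bar> < int n")
      case True
      then show ?thesis using IH[OF True] nb(1)[OF True] by (simp add: z_def)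
    next
      case False
      then have "\<bar>p + 1\<bar> = int n" using Suc.prems(2) by linarith
      moreover have "z + (0, 1) = slot m (p + 1) (r + shift p - shift (p + 1))"
        using shift_minus[of p] shift_minus[of "p + 1"] by (simp add: z_def slot_def)
      ultimately show ?thesis using boundary gb by simp
    qed
    moreover have "g p \<le> g (p - 1)" "g p \<le> g (p + 1) + 1"
      using heights_valid[OF valid, of j m p P] j Suc.prems(2) by (auto simp: g_def)
    moreover have "\<exists>q r. z = slot m q r \<and> 0 \<le> r"
      unfolding z_def r_def by (metis of_nat_0_le_iff)
    ultimately have "R (z + (1, 1)) (if z \<in> slots m P then g p else min (g (p - 1)) (g (p + 1) + 1))"
      by (intro step)
    moreover have "z \<in> slots m P \<longleftrightarrow> j \<in> P"
      unfolding z_def r_def by (rule slot_in_slots_iff[OF pi j])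
    moreover have "z + (1, 1) = slot m p (r + 1)" by (simp add: z_def slot_def)
    moreover have "heights m P h (Suc j) p = (if j \<in> P then g p else min (g (p - 1)) (g (p + 1) + 1))"
      using True by (simp add: hs height_step_def)
    ultimately show ?thesis using ip r' by simp
  qed
qed

end

section \<open>Low heights and chains of slots\<close>

lemma height_id:
  assumes "\<bar>t\<bar> \<le> int n" "p \<le> int n"
  shows "height n t id p = max 0 (t - p)"
proof -
  have "height n t id p = int (card ({p<..int n} \<inter> {q. q \<le> t}))"
    by (simp add: height_def)
  also have "{p<..int n} \<inter> {q. q \<le> t} = {p<..t}" using assms by auto
  finally show ?thesis by (simp add: max_def del: id_apply)
qed

text \<open>Lifts of pairwise crossing diagonals: for \<open>(x, y)\<close> below
  \<open>(x', y')\<close> the conditions read \<open>x < x' < y < y' < x + 2m\<close>. The last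
  clause includes \<open>c = d\<close>, where it places the point in the strip of lifts.\<close>

definition slot_chain :: "nat \<Rightarrow> (int \<times> int) set \<Rightarrow> bool" where
  "slot_chain m Z \<longleftrightarrow> finite Z \<and>
     (\<forall>c\<in>Z. \<forall>d\<in>Z. c \<noteq> d \<longrightarrow>
       (fst c < fst d \<and> snd c < snd d) \<or> (fst d < fst c \<and> snd d < snd c)) \<and>
     (\<forall>c\<in>Z. \<forall>d\<in>Z. fst d < snd c \<and> snd d < fst c + 2 * int m)"

context coxeter_word
begin

lemma heights_id_invariant:
  fixes R :: "int \<times> int \<Rightarrow> int \<Rightarrow> bool"
  assumes t: "\<bar>t\<bar> \<le> int n"
    and init: "\<And>p. \<bar>p\<bar> < int n \<Longrightarrow> R (slot m p 0) (max 0 (t - p))"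
    and boundary: "\<And>r. R (slot m (int n) r) 0" "\<And>r. R (slot m (- int n) r) (t + int n)"
    and step: "\<And>z v l u. \<exists>q r. z = slot m q r \<and> 0 \<le> r \<Longrightarrow> R z v \<Longrightarrow> R (z + (1, 0)) l \<Longrightarrow> R (z + (0, 1)) u \<Longrightarrow> v \<le> l \<Longrightarrow> v \<le> u + 1 \<Longrightarrow>
        R (z + (1, 1)) (if z \<in> slots m P then v else min l (u + 1))"
    and p: "\<bar>p\<bar> < int n"
  shows "R (slot m p (int m)) (heights m P (height n t id) (n * m) p)"
proof -
  have "0 < n" using p by simp
  moreover have "R (slot m p (rounds (n * m) (nat \<bar>p\<bar>))) (heights m P (height n t id) (n * m) p)"
  proof (rule heights_invariant[where h = "height n t id" and m = m and P = P and R = R])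
    show "R (z + (1, 1)) (if z \<in> slots m P then v else min l (u + 1))"
      if "\<exists>q r. z = slot m q r \<and> 0 \<le> r" "R z v" "R (z + (1, 0)) l" "R (z + (0, 1)) u" "v \<le> l" "v \<le> u + 1"
      for z v l u using step that by blast
    show "R (slot m p r) (height n t id p)" if "\<bar>p\<bar> = int n" for p r
    proof -
      have "p = int n \<or> p = - int n" using that by linarith
      then show ?thesis using boundary[of r] t height_id[OF t, of p] by auto
    qed
  qed (use t p init in \<open>auto simp: height_id max_def\<close>)
  ultimately show ?thesis by (simp add: rounds_end)
qed

text \<open>
  The height \<open>v\<close> in front of the slot \<open>z\<close> is a minimum over monotone lattice paths from \<open>z\<close> downwards,
  which step diagonally at slots in \<open>P\<close> and by one coordinate at all others. The list \<open>C\<close> collects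
  the diagonal steps of an optimal path, \<open>U\<close> and \<open>D\<close> count the steps in the first and
  second coordinate, and \<open>e\<close> is the end of the path.
\<close>

definition traced :: "nat \<Rightarrow> nat set \<Rightarrow> int \<Rightarrow> int \<times> int \<Rightarrow> int \<Rightarrow> bool" where
  "traced m P t z v \<longleftrightarrow> (\<exists>e C U D. 0 \<le> U \<and> 0 \<le> D \<and>
     fst z = fst e + int (length C) + U \<and> snd z = snd e + int (length C) + D \<and>
     v = U + max 0 (t - (snd e - fst e - int m)) \<and>
     ((\<exists>q. \<bar>q\<bar> < int n \<and> e = slot m q 0) \<or> \<bar>snd e - fst e - int m\<bar> = int n) \<and>
     set C \<subseteq> slots m P \<and> sorted_wrt (\<lambda>c d. fst c < fst d \<and> snd c < snd d) C \<and>
     (\<forall>c\<in>set C. fst c < fst z \<and> snd c < snd z) \<and>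
     (\<forall>i<length C. fst e + int i \<le> fst (C ! i) \<and> snd e + int i \<le> snd (C ! i)))"

lemma slot_diff: "snd (slot m p r) - fst (slot m p r) - int m = p"
  by (simp add: slot_def shift_minus)

lemma traced_start:
  assumes "\<bar>q\<bar> < int n \<and> r = 0 \<or> \<bar>q\<bar> = int n" "v = max 0 (t - q)"
  shows "traced m P t (slot m q r) v"
  unfolding traced_def
  using assms slot_diff[of m q r]
  by (intro exI[of _ "slot m q r"] exI[of _ "[]"] exI[of _ 0]) auto

text \<open>A deleted slot is crossed diagonally at no cost. Otherwise the minimum tells which
  neighbour the path uses: \<open>z + (1, 0)\<close> by a free step in the second coordinate, or
  \<open>z + (0, 1)\<close> by a step in the first, which costs 1.\<close>

lemma traced_step:
  assumes "traced m P t z v" "traced m P t (z + (1, 0)) l" "traced m P t (z + (0, 1)) u"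
  shows "traced m P t (z + (1, 1)) (if z \<in> slots m P then v else min l (u + 1))"
proof -
  consider "z \<in> slots m P" | "z \<notin> slots m P" "min l (u + 1) = l" | "z \<notin> slots m P" "min l (u + 1) = u + 1"
    by linarith
  then show ?thesis
  proof cases
    case 1
    obtain e C U D where *: "0 \<le> U" "0 \<le> D" "fst z = fst e + int (length C) + U"
        "snd z = snd e + int (length C) + D" "v = U + max 0 (t - (snd e - fst e - int m))"
        "(\<exists>q. \<bar>q\<bar> < int n \<and> e = slot m q 0) \<or> \<bar>snd e - fst e - int m\<bar> = int n"
        "set C \<subseteq> slots m P" "sorted_wrt (\<lambda>c d. fst c < fst d \<and> snd c < snd d) C"
        "\<forall>c\<in>set C. fst c < fst z \<and> snd c < snd z"
        "\<forall>i<length C. fst e + int i \<le> fst (C ! i) \<and> snd e + int i \<le> snd (C ! i)"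
      using assms(1) unfolding traced_def by blast
    have "\<forall>i<length (C @ [z]). fst e + int i \<le> fst ((C @ [z]) ! i) \<and> snd e + int i \<le> snd ((C @ [z]) ! i)"
      using * by (auto simp: nth_append less_Suc_eq)
    moreover have "sorted_wrt (\<lambda>c d. fst c < fst d \<and> snd c < snd d) (C @ [z])"
      using * by (auto simp: sorted_wrt_append)
    moreover have "\<forall>c\<in>set (C @ [z]). fst c < fst (z + (1, 1)) \<and> snd c < snd (z + (1, 1))"
      using *(9) by force
    ultimately show ?thesis
      unfolding traced_def using * 1
      by (intro exI[of _ e] exI[of _ "C @ [z]"] exI[of _ U] exI[of _ D]) auto
  next
    case 2
    then obtain e C U D where *: "0 \<le> U" "0 \<le> D" "fst z + 1 = fst e + int (length C) + U"
        "snd z = snd e + int (length C) + D" "l = U + max 0 (t - (snd e - fst e - int m))"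
        "(\<exists>q. \<bar>q\<bar> < int n \<and> e = slot m q 0) \<or> \<bar>snd e - fst e - int m\<bar> = int n"
        "set C \<subseteq> slots m P" "sorted_wrt (\<lambda>c d. fst c < fst d \<and> snd c < snd d) C"
        "\<forall>c\<in>set C. fst c < fst z + 1 \<and> snd c < snd z"
        "\<forall>i<length C. fst e + int i \<le> fst (C ! i) \<and> snd e + int i \<le> snd (C ! i)"
      using assms(2) unfolding traced_def fst_add snd_add fst_conv snd_conv add_0_right by blast
    have "\<forall>c\<in>set C. fst c < fst (z + (1, 1)) \<and> snd c < snd (z + (1, 1))"
      using *(9) by (metis fst_add snd_add fst_conv snd_conv less_add_one less_trans)
    then show ?thesis
      unfolding traced_def using *(1-8) *(10) 2
      by (intro exI[of _ e] exI[of _ C] exI[of _ U] exI[of _ "D + 1"]) simp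
  next
    case 3
    then obtain e C U D where *: "0 \<le> U" "0 \<le> D" "fst z = fst e + int (length C) + U"
        "snd z + 1 = snd e + int (length C) + D" "u = U + max 0 (t - (snd e - fst e - int m))"
        "(\<exists>q. \<bar>q\<bar> < int n \<and> e = slot m q 0) \<or> \<bar>snd e - fst e - int m\<bar> = int n"
        "set C \<subseteq> slots m P" "sorted_wrt (\<lambda>c d. fst c < fst d \<and> snd c < snd d) C"
        "\<forall>c\<in>set C. fst c < fst z \<and> snd c < snd z + 1"
        "\<forall>i<length C. fst e + int i \<le> fst (C ! i) \<and> snd e + int i \<le> snd (C ! i)"
      using assms(3) unfolding traced_def fst_add snd_add fst_conv snd_conv add_0_right by blast
    have "\<forall>c\<in>set C. fst c < fst (z + (1, 1)) \<and> snd c < snd (z + (1, 1))"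
      using *(9) by (metis fst_add snd_add fst_conv snd_conv less_add_one less_trans)
    then show ?thesis
      unfolding traced_def using *(1-8) *(10) 3
      by (intro exI[of _ e] exI[of _ C] exI[of _ "U + 1"] exI[of _ D]) simp
  qed
qed

text \<open>A cost below \<open>n - p\<close> bounds both \<open>U\<close> and \<open>D\<close>, so
  the path cannot end at the walls \<open>n\<close> and \<open>- n\<close> and descends to round 0.
  Over that distance more than \<open>m - n\<close> of its steps are diagonal.\<close>

lemma slot_chain_if_low:
  assumes nm: "n \<le> m" and p: "\<bar>p\<bar> < int n"
    and low: "heights m P (height n (- p) id) (n * m) p < int n - p"
  shows "\<exists>Z\<subseteq>slots m P. slot_chain m Z \<and> card Z = Suc (m - n)"
proof -
  define v where "v = heights m P (height n (- p) id) (n * m) p"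
  have "traced m P (- p) (slot m p (int m)) v"
    unfolding v_def
  proof (rule heights_id_invariant[where R = "traced m P (- p)" and t = "- p"])
    show "traced m P (- p) (z + (1, 1)) (if z \<in> slots m P then v else min l (u + 1))"
      if "traced m P (- p) z v" "traced m P (- p) (z + (1, 0)) l" "traced m P (- p) (z + (0, 1)) u"
      for z v l u using traced_step that by blast
  qed (use p in \<open>auto intro!: traced_start\<close>)
  then obtain e C U D where *: "0 \<le> U" "0 \<le> D" "fst (slot m p (int m)) = fst e + int (length C) + U"
      "snd (slot m p (int m)) = snd e + int (length C) + D" "v = U + max 0 (- p - (snd e - fst e - int m))"
      "(\<exists>q. \<bar>q\<bar> < int n \<and> e = slot m q 0) \<or> \<bar>snd e - fst e - int m\<bar> = int n"
      "set C \<subseteq> slots m P" "sorted_wrt (\<lambda>c d. fst c < fst d \<and> snd c < snd d) C"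
      "\<forall>c\<in>set C. fst c < fst (slot m p (int m)) \<and> snd c < snd (slot m p (int m))"
      "\<forall>i<length C. fst e + int i \<le> fst (C ! i) \<and> snd e + int i \<le> snd (C ! i)"
    unfolding traced_def by blast
  define x y where "x = fst (slot m p (int m))" and "y = snd (slot m p (int m))"
  have yx: "y - x = int m + p" using slot_diff[of m p "int m"] by (simp add: x_def y_def)
  have diff: "snd e - fst e - int m = p + U - D" using *(3,4) yx by (simp add: x_def y_def)
  have U: "U < int n - p" and D: "D < int n + p"
    using low *(5) diff by (auto simp: v_def max_def split: if_splits)
  then have "\<bar>p + U - D\<bar> < int n" using *(1,2) by linarith
  then obtain q where q: "\<bar>q\<bar> < int n" "e = slot m q 0" using *(6) diff by auto
  then have qp: "q = p + U - D" using diff slot_diff[of m q 0] by simp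
  have L: "int m + shift p - shift q = int (length C) + U"
    using *(3) q(2) by (simp add: slot_def)
  \<comment> \<open>For \<open>q \<le> - p\<close> the bound on \<open>D\<close> is decisive,
    otherwise the bound on \<open>U\<close>.\<close>
  have "int (length C) \<ge> int m - int n + 1"
  proof (cases "q \<le> - p")
    case True
    then show ?thesis using shift_bounds[OF True] shift_minus[of p] L D qp by linarith
  next
    case False
    then show ?thesis using shift_antimono[of "- p" q] shift_minus[of p] L U by linarith
  qed
  then have len: "Suc (m - n) \<le> length C" using nm by linarith
  \<comment> \<open>The \<open>m - n + 1\<close> diagonal steps nearest to the top are kept: they
    are close enough to it for their coordinates to fit into the window of a
    \<open>slot_chain\<close>.\<close>
  define s where "s = length C - Suc (m - n)"
  define Z where "Z = set (drop s C)"
  have sorted: "sorted_wrt (\<lambda>c d. fst c < fst d \<and> snd c < snd d) (drop s C)"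
    using *(8) by (rule sorted_wrt_drop)
  have "distinct (drop s C)"
    using sorted by (auto simp: distinct_conv_nth sorted_wrt_iff_nth_less) (metis less_irrefl linorder_neqE_nat)
  then have card: "card Z = Suc (m - n)"
    unfolding Z_def using len by (simp add: distinct_card s_def)
  have Zx: "x - U - int (Suc (m - n)) \<le> fst c" "y - D - int (Suc (m - n)) \<le> snd c" "fst c < x" "snd c < y" if "c \<in> Z" for c
  proof -
    obtain i where i: "i < length (drop s C)" "c = drop s C ! i"
      using \<open>c \<in> Z\<close> unfolding Z_def by (auto simp: in_set_conv_nth)
    then have "fst e + int (s + i) \<le> fst c" "snd e + int (s + i) \<le> snd c"
      using *(10)[rule_format, of "s + i"] by auto
    moreover have "int s = int (length C) - int (Suc (m - n))" using len by (simp add: s_def)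
    ultimately show "x - U - int (Suc (m - n)) \<le> fst c" "y - D - int (Suc (m - n)) \<le> snd c"
      using *(3,4) by (auto simp: x_def y_def)
    show "fst c < x" "snd c < y"
      using *(9) \<open>c \<in> Z\<close> unfolding Z_def x_def y_def by (auto dest: in_set_dropD)
  qed
  have "slot_chain m Z"
    unfolding slot_chain_def
  proof (intro conjI ballI impI)
    show "finite Z" by (simp add: Z_def)
    fix c d assume cd: "c \<in> Z" "d \<in> Z"
    have "int (Suc (m - n)) = int m - int n + 1" using nm by simp
    then show "fst d < snd c" "snd d < fst c + 2 * int m"
      using Zx(1,2)[OF cd(1)] Zx(3,4)[OF cd(2)] U D yx by linarith+
    assume "c \<noteq> d"
    obtain i j where "i < length (drop s C)" "c = drop s C ! i" "j < length (drop s C)" "d = drop s C ! j"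
      using cd unfolding Z_def by (metis in_set_conv_nth)
    then show "fst c < fst d \<and> snd c < snd d \<or> fst d < fst c \<and> snd d < snd c"
      using sorted \<open>c \<noteq> d\<close> unfolding sorted_wrt_iff_nth_less by (metis linorder_neqE_nat)
  qed
  moreover have "Z \<subseteq> slots m P" using *(7) unfolding Z_def by (meson set_drop_subset subset_trans)
  ultimately show ?thesis using card by blast
qed

text \<open>As \<open>shift\<close> is antitone, the first coordinates decide for
  \<open>p \<le> p'\<close> and the second ones otherwise.\<close>

lemma slot_le_rounds:
  assumes "fst (slot m p r) \<le> fst (slot m p' r')" "snd (slot m p r) \<le> snd (slot m p' r')"
  shows "r \<le> r'"
proof (cases "p \<le> p'")
  case True
  then show ?thesis using shift_antimono[of p p'] assms by (simp add: slot_def)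
next
  case False
  then show ?thesis using shift_antimono[of "- p" "- p'"] assms by (simp add: slot_def)
qed

lemma slots_elim:
  assumes "c \<in> slots m P"
  obtains p r where "c = slot m p r" "\<bar>p\<bar> < int n" "0 \<le> r" "r < int m"
proof -
  obtain j p where j: "c = slot m p (int (j div n))" "j < n * m" "\<bar>p\<bar> = int (cw ! (j mod n))"
    using assms unfolding slots_def by blast
  then have "0 < n" by (cases n) auto
  then have "\<bar>p\<bar> < int n" using j nth_less[of "j mod n"] by simp
  moreover have "int (j div n) < int m" using j(2) by (simp add: less_mult_imp_div_less mult.commute)
  ultimately show ?thesis using that[of p "int (j div n)"] j by simp
qed

text \<open>With \<open>a\<close> and \<open>b\<close> the largest and the smallest point of
  \<open>Z\<close>, the top slot must lie strictly above \<open>a\<close> and weakly below the half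
  turn \<open>(snd b, fst b + 2m)\<close> of \<open>b\<close>. The wall of \<open>a\<close> achieves
  the former, the negative of the wall of \<open>b\<close> the latter. Between these walls both
  coordinates of the top slots move monotonically in steps of at most 1, so an intermediate value
  achieves both.\<close>

lemma exists_top_slot:
  assumes Z: "Z \<subseteq> slots m P" "slot_chain m Z" "Z \<noteq> {}"
  obtains p where "\<bar>p\<bar> < int n"
    "\<And>c. c \<in> Z \<Longrightarrow> fst c < fst (slot m p (int m)) \<and> snd c < snd (slot m p (int m))"
    "\<And>c. c \<in> Z \<Longrightarrow> fst (slot m p (int m)) \<le> snd c \<and> snd (slot m p (int m)) \<le> fst c + 2 * int m"
proof -
  have fin: "finite Z" using Z by (simp add: slot_chain_def)
  have comp: "(fst c < fst d \<and> snd c < snd d) \<or> (fst d < fst c \<and> snd d < snd c)"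
    if "c \<in> Z" "d \<in> Z" "c \<noteq> d" for c d using Z that by (auto simp: slot_chain_def)
  have "Max (fst ` Z) \<in> fst ` Z" "Min (fst ` Z) \<in> fst ` Z" using fin Z(3) by auto
  then obtain a b where ab: "a \<in> Z" "fst a = Max (fst ` Z)" "b \<in> Z" "fst b = Min (fst ` Z)" by auto
  have a: "a \<in> Z" "\<And>c. c \<in> Z \<Longrightarrow> fst c \<le> fst a" and b: "b \<in> Z" "\<And>c. c \<in> Z \<Longrightarrow> fst b \<le> fst c"
    using ab fin by auto
  have a2: "snd c \<le> snd a" if "c \<in> Z" for c
    using comp[OF a(1) that] a(2)[OF that] by (cases "a = c") auto
  have b2: "snd b \<le> snd c" if "c \<in> Z" for c
    using comp[OF b(1) that] b(2)[OF that] by (cases "b = c") auto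
  obtain pa ra where pa: "a = slot m pa ra" "\<bar>pa\<bar> < int n" "0 \<le> ra" "ra < int m"
    using slots_elim a(1) Z(1) by blast
  obtain pb rb where pb: "b = slot m pb rb" "\<bar>pb\<bar> < int n" "0 \<le> rb" "rb < int m"
    using slots_elim b(1) Z(1) by blast
  have ab: "fst a < snd b" "snd a < fst b + 2 * int m"
    using Z(2) a(1) b(1) by (auto simp: slot_chain_def)
  define f g where "f p = int m + shift p" and "g p = 2 * int m + shift (- p)" for p
  have slot: "slot m p (int m) = (f p, g p)" for p by (simp add: slot_def f_def g_def)
  have "f pa > fst a" "g pa > snd a" using pa by (auto simp: f_def g_def slot_def)
  moreover have "f (- pb) \<le> snd b" "g (- pb) \<le> fst b + 2 * int m" using pb by (auto simp: f_def g_def slot_def)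
  ultimately have "\<exists>p. \<bar>p\<bar> < int n \<and> fst a < f p \<and> snd a < g p \<and> f p \<le> snd b \<and> g p \<le> fst b + 2 * int m"
  proof -
    assume A: "f pa > fst a" "g pa > snd a" and B: "f (- pb) \<le> snd b" "g (- pb) \<le> fst b + 2 * int m"
    have f_anti: "f q \<le> f p" and g_mono: "g p \<le> g q" if "p \<le> q" for p q
      using shift_antimono[of p q] shift_antimono[of "- q" "- p"] that by (auto simp: f_def g_def)
    have f_step: "\<bar>f (p + 1) - f p\<bar> \<le> 1" and g_step: "\<bar>g (p + 1) - g p\<bar> \<le> 1" for p
      using shift_Suc_bounds[of p] shift_Suc_bounds[of "- p - 1"] by (auto simp: f_def g_def)
    consider "f pa \<le> snd b" "g pa \<le> fst b + 2 * int m" | "f pa > snd b" | "g pa > fst b + 2 * int m"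
      by linarith
    then show ?thesis
    proof cases
      case 1
      then show ?thesis using A pa(2) by blast
    next
      case 2
      then have "pa < - pb" using B(1) f_anti[of "- pb" pa] by linarith
      then obtain N where N: "- pb = pa + int N" by (metis zless_iff_Suc_zadd)
      have "\<exists>i\<le>N. - f (pa + int i) = - snd b"
      proof (rule nat0_intermed_int_val)
        have "\<bar>- f (pa + int (i + 1)) - - f (pa + int i)\<bar> \<le> 1" for i
          using f_step[of "pa + int i"] by (simp add: add.assoc add.commute[of 1])
        then show "\<forall>i<N. \<bar>- f (pa + int (i + 1)) - - f (pa + int i)\<bar> \<le> 1" by blast
      qed (use 2 B N in auto)
      then obtain i where i: "i \<le> N" "f (pa + int i) = snd b" by auto
      moreover have "g pa \<le> g (pa + int i)" "g (pa + int i) \<le> g (- pb)"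
        using g_mono N i by auto
      ultimately show ?thesis using A B ab pa(2) pb(2) N
        by (intro exI[of _ "pa + int i"]) auto
    next
      case 3
      then have "- pb < pa" using B(2) g_mono[of pa "- pb"] by linarith
      then obtain N where N: "pa = - pb + int N" by (metis zless_iff_Suc_zadd)
      have "\<exists>i\<le>N. g (- pb + int i) = fst b + 2 * int m"
      proof (rule nat0_intermed_int_val)
        have "\<bar>g (- pb + int (i + 1)) - g (- pb + int i)\<bar> \<le> 1" for i
          using g_step[of "- pb + int i"] by (simp only: of_nat_add of_nat_1 add.assoc)
        then show "\<forall>i<N. \<bar>g (- pb + int (i + 1)) - g (- pb + int i)\<bar> \<le> 1" by blast
      qed (use 3 B N in auto)
      then obtain i where i: "i \<le> N" "g (- pb + int i) = fst b + 2 * int m" by auto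
      moreover have "f pa \<le> f (- pb + int i)" "f (- pb + int i) \<le> f (- pb)"
        using f_anti N i by auto
      ultimately show ?thesis using A B ab pa(2) pb(2) N
        by (intro exI[of _ "- pb + int i"]) auto
    qed
  qed
  then obtain p where p: "\<bar>p\<bar> < int n" "fst a < f p" "snd a < g p" "f p \<le> snd b" "g p \<le> fst b + 2 * int m"
    by blast
  show ?thesis
    using that[of p] p a(2) a2 b(2) b2 by (fastforce simp: slot)
qed

text \<open>The chain lies between the corner \<open>(xe, ye)\<close>, the first slot of the wall
  \<open>- p\<close>, and the half turn of that corner, the top slot of the wall \<open>p\<close>.
  The distance in the first coordinate is \<open>m - p\<close> and each of the
  \<open>m - n + 1\<close> points saves one unit, which leaves at most
  \<open>n - p - 1\<close>.\<close>

lemma low_if_slot_chain: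
  assumes nm: "n \<le> m" and Z: "Z \<subseteq> slots m P" "slot_chain m Z" "card Z = Suc (m - n)"
  obtains p where "\<bar>p\<bar> < int n" "heights m P (height n (- p) id) (n * m) p < int n - p"
proof -
  have fin: "finite Z" and "Z \<noteq> {}" using Z by (auto simp: slot_chain_def)
  have comp: "(fst c < fst d \<and> snd c < snd d) \<or> (fst d < fst c \<and> snd d < snd c)"
    if "c \<in> Z" "d \<in> Z" "c \<noteq> d" for c d using Z that by (auto simp: slot_chain_def)
  obtain p where p: "\<bar>p\<bar> < int n"
    and top: "\<And>c. c \<in> Z \<Longrightarrow> fst c < fst (slot m p (int m)) \<and> snd c < snd (slot m p (int m))"
    and bot: "\<And>c. c \<in> Z \<Longrightarrow> fst (slot m p (int m)) \<le> snd c \<and> snd (slot m p (int m)) \<le> fst c + 2 * int m"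
    using exists_top_slot[OF Z(1,2) \<open>Z \<noteq> {}\<close>] by metis
  define xe ye where "xe = fst (slot m (- p) 0)" and "ye = snd (slot m (- p) 0)"
  have e: "xe \<le> fst c" "ye \<le> snd c" if "c \<in> Z" for c
    using bot[OF that] by (auto simp: xe_def ye_def slot_def)
  define B where "B z = {c \<in> Z. fst c < fst z \<and> snd c < snd z}" for z :: "int \<times> int"
  define N where "N z = int (card (B z))" for z :: "int \<times> int"
  \<comment> \<open>\<open>N z\<close> is the saving available below \<open>z\<close>. Instead of
    choosing a path through the chain, the bound is propagated over the whole quadrant above the
    corner.\<close>
  define R where "R z v \<longleftrightarrow> (xe \<le> fst z \<and> ye \<le> snd z \<longrightarrow> v \<le> fst z - xe - N z)" for z :: "int \<times> int" and v
  have finB: "finite (B z)" for z using fin by (simp add: B_def)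
  \<comment> \<open>A chain meets each row and each column at most once. \<open>N_fst\<close>
    settles the wall \<open>n\<close>, \<open>N_snd\<close> the wall \<open>- n\<close>.\<close>
  have N_fst: "N z \<le> fst z - xe" if "xe \<le> fst z" for z
  proof -
    have "inj_on fst (B z)" using comp unfolding B_def inj_on_def by (metis (no_types, lifting) less_irrefl mem_Collect_eq)
    moreover have "fst ` B z \<subseteq> {xe..<fst z}" using e by (auto simp: B_def)
    ultimately have "card (B z) \<le> card {xe..<fst z}" by (meson card_inj_on_le finite_atLeastLessThan_int)
    then show ?thesis using that by (simp add: N_def)
  qed
  have N_snd: "N z \<le> snd z - ye" if "ye \<le> snd z" for z
  proof -
    have "inj_on snd (B z)" using comp unfolding B_def inj_on_def by (metis (no_types, lifting) less_irrefl mem_Collect_eq)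
    moreover have "snd ` B z \<subseteq> {ye..<snd z}" using e by (auto simp: B_def)
    ultimately have "card (B z) \<le> card {ye..<snd z}" by (meson card_inj_on_le finite_atLeastLessThan_int)
    then show ?thesis using that by (simp add: N_def)
  qed
  have "R (slot m p (int m)) (heights m P (height n (- p) id) (n * m) p)"
  proof (rule heights_id_invariant[where R = R and t = "- p"])
    show "\<bar>- p\<bar> \<le> int n" using p by simp
    show "R (slot m q 0) (max 0 (- p - q))" for q
    proof -
      have "B (slot m q 0) = {}"
      proof (rule ccontr)
        assume "B (slot m q 0) \<noteq> {}"
        then obtain c where c: "c \<in> Z" "fst c < fst (slot m q 0)" "snd c < snd (slot m q 0)"
          by (auto simp: B_def)
        obtain q' r where q': "c = slot m q' r" "0 \<le> r" using slots_elim c(1) Z(1) by blast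
        have "r + 1 \<le> 0"
          using c q' slot_le_rounds[of m q' "r + 1" q 0] by (simp add: slot_def)
        then show False using q' by simp
      qed
      then show ?thesis
        unfolding R_def N_def using shift_minus[of q] shift_minus[of p]
        by (simp add: xe_def ye_def slot_def)
    qed
    show "R (slot m (int n) r) 0" for r
      unfolding R_def using N_fst by simp
    show "R (slot m (- int n) r) (- p + int n)" for r
      unfolding R_def using N_snd[of "slot m (- int n) r"] slot_diff[of m "- int n" r] slot_diff[of m "- p" 0]
      by (auto simp: xe_def ye_def)
    show "R (z + (1, 1)) (if z \<in> slots m P then v else min l (u + 1))"
      if zr: "\<exists>q r. z = slot m q r \<and> 0 \<le> r" and vR: "R z v" and lR: "R (z + (1, 0)) l" and uR: "R (z + (0, 1)) u" and le: "v \<le> l" "v \<le> u + 1" for z v l u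
    proof (cases "xe \<le> fst z + 1 \<and> ye \<le> snd z + 1")
      case False
      then show ?thesis by (auto simp: R_def)
    next
      case in_range: True
      define w where "w = (if z \<in> slots m P then v else min l (u + 1))"
      \<comment> \<open>This holds at deleted slots too, so deletions outside \<open>Z\<close> do
        not spoil the bound.\<close>
      have wl: "w \<le> l" "w \<le> u + 1" using le by (auto simp: w_def)
      have "w \<le> fst z + 1 - xe - N (z + (1, 1))"
      proof (cases "z \<in> Z")
        case True
        then have "w = v" using Z(1) by (auto simp: w_def)
        moreover have "v \<le> fst z - xe - N z" using vR e[OF True] by (simp add: R_def)
        moreover have "B (z + (1, 1)) \<subseteq> insert z (B z)"
          using comp[OF _ True] by (force simp: B_def)
        then have "card (B (z + (1, 1))) \<le> card (insert z (B z))"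
          using finB by (intro card_mono) auto
        then have "card (B (z + (1, 1))) \<le> Suc (card (B z))"
          using finB by (auto simp: card_insert_if split: if_splits)
        then have "N (z + (1, 1)) \<le> N z + 1" by (simp add: N_def)
        ultimately show ?thesis by linarith
      next
        case notin: False
        show ?thesis
        proof (cases "B (z + (1, 1)) = {}")
          case True
          have "B (z + (1, 0)) \<subseteq> B (z + (1, 1))" "B (z + (0, 1)) \<subseteq> B (z + (1, 1))" by (auto simp: B_def)
          then have N0: "N (z + (1, 1)) = 0" "N (z + (1, 0)) = 0" "N (z + (0, 1)) = 0" using True by (auto simp: N_def)
          \<comment> \<open>At the corner itself neither neighbour is in range, but there
            \<open>z\<close> would have a negative round.\<close>
          have "\<not> (xe = fst z + 1 \<and> ye = snd z + 1)"
          proof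
            assume "xe = fst z + 1 \<and> ye = snd z + 1"
            moreover obtain q r where "z = slot m q r" "0 \<le> r" using zr by blast
            ultimately show False
              using slot_le_rounds[of m q "r + 1" "- p" 0] by (simp add: slot_def xe_def ye_def)
          qed
          then consider "xe \<le> fst z" | "ye \<le> snd z" using in_range by linarith
          then show ?thesis
          proof cases
            case 1
            then show ?thesis using uR N0 in_range wl by (simp add: R_def)
          next
            case 2
            then show ?thesis using lR N0 in_range wl by (simp add: R_def)
          qed
        next
          case False
          then obtain c where "c \<in> Z" "fst c \<le> fst z" "snd c \<le> snd z" by (auto simp: B_def)
          then have ez: "xe \<le> fst z" "ye \<le> snd z" using e[of c] by auto
          \<comment> \<open>Otherwise \<open>Z\<close> would have one point in the row and another
            in the column of \<open>z\<close>, both weakly below it and hence incomparable.\<close>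
          have "B (z + (1, 1)) = B (z + (1, 0)) \<or> B (z + (1, 1)) = B (z + (0, 1))"
          proof (rule ccontr)
            assume "\<not> ?thesis"
            then obtain c d where c: "c \<in> Z" "fst c \<le> fst z" "snd c = snd z" and d: "d \<in> Z" "fst d = fst z" "snd d \<le> snd z"
              by (fastforce simp: B_def)
            then have "c \<noteq> d" using notin by (metis prod.collapse)
            then show False using comp[OF c(1) d(1)] c d by auto
          qed
          then show ?thesis
          proof
            assume "B (z + (1, 1)) = B (z + (1, 0))"
            then show ?thesis using lR ez wl by (simp add: R_def N_def)
          next
            assume "B (z + (1, 1)) = B (z + (0, 1))"
            then show ?thesis using uR ez wl by (simp add: R_def N_def)
          qed
        qed
      qed
      then show ?thesis by (simp add: R_def w_def)
    qed
  qed (use p in auto)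
  moreover have "B (slot m p (int m)) = Z" using top by (auto simp: B_def)
  moreover have "xe \<le> fst (slot m p (int m))" "ye \<le> snd (slot m p (int m))"
    using e top \<open>Z \<noteq> {}\<close> by (meson all_not_in_conv less_imp_le order_trans)+
  moreover have "fst (slot m p (int m)) - xe = int m - p"
    by (simp add: xe_def slot_def shift_minus)
  ultimately have "heights m P (height n (- p) id) (n * m) p \<le> int m - p - int (Suc (m - n))"
    using Z(3) by (simp add: R_def N_def)
  then show ?thesis using that[OF p] nm by simp
qed

end

section \<open>Diagonals\<close>

definition diag :: "nat \<Rightarrow> int \<times> int \<Rightarrow> nat set" where
  "diag m z = {nat (fst z mod (2 * int m)), nat (snd z mod (2 * int m))}"

lemma diag_shift: "diag m (x + 2 * int m * q, y + 2 * int m * q) = diag m (x, y)"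
  by (simp add: diag_def)

lemma diag_swap: "diag m (y, x + 2 * int m) = diag m (x, y)"
  by (auto simp: diag_def)

lemma diag_lifts:
  assumes "x < y" "y < x + 2 * int m" "x' < y'" "y' < x' + 2 * int m" "diag m (x, y) = diag m (x', y')"
  shows "\<exists>q. x' = x + 2 * int m * q \<and> y' = y + 2 * int m * q \<or>
    x' = y + 2 * int m * q \<and> y' = x + 2 * int m + 2 * int m * q"
proof -
  define M where "M = 2 * int m"
  have M: "0 < M" using assms by (simp add: M_def)
  have lift: "\<exists>q. a' = a + M * q" if "nat (a mod M) = nat (a' mod M)" for a a' :: int
  proof -
    have "a mod M = a' mod M" using that M by (simp add: eq_nat_nat_iff)
    then show ?thesis by (metis mod_eqE)
  qed
  have "nat (x mod M) = nat (x' mod M) \<and> nat (y mod M) = nat (y' mod M) \<or>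
      nat (y mod M) = nat (x' mod M) \<and> nat (x mod M) = nat (y' mod M)"
    using assms(5) by (auto simp: diag_def M_def doubleton_eq_iff)
  then consider q1 q2 where "x' = x + M * q1" "y' = y + M * q2" | q1 q2 where "x' = y + M * q1" "y' = x + M * q2"
    using lift by meson
  then show ?thesis
  proof cases
    case 1
    then have "M * (q2 - q1) < M * 1" "M * (- 1) < M * (q2 - q1)"
      using assms(1-4) unfolding right_diff_distrib M_def[symmetric] by linarith+
    then have "q2 - q1 < 1" "- 1 < q2 - q1" using M by (simp_all only: mult_less_cancel_left_pos)
    then have "q2 = q1" by simp
    then show ?thesis using 1 by (auto simp: M_def)
  next
    case 2
    then have "M * (q2 - q1) < M * 2" "M * 0 < M * (q2 - q1)"
      using assms(1-4) unfolding right_diff_distrib M_def[symmetric] by linarith+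
    then have "q2 - q1 < 2" "0 < q2 - q1" using M by (simp_all only: mult_less_cancel_left_pos)
    then have "q2 = q1 + 1" by simp
    then have "x' = y + 2 * int m * q1 \<and> y' = x + 2 * int m + 2 * int m * q1"
      using 2 by (simp add: M_def algebra_simps)
    then show ?thesis by blast
  qed
qed

lemma crosses_nat:
  assumes "0 \<le> a" "a < c" "c < b" "b < (d :: int)"
  shows "crosses {nat a, nat b} {nat c, nat d}"
  unfolding crosses_def
  using assms by (intro exI[of _ "nat a"] exI[of _ "nat b"] exI[of _ "nat c"] exI[of _ "nat d"]) auto

lemma crosses_sym: "crosses d e \<Longrightarrow> crosses e d"
  unfolding crosses_def by blast

lemma crosses_diag:
  assumes "x < x'" "x' < y" "y < y'" "y' < x + 2 * int m"
  shows "crosses (diag m (x, y)) (diag m (x', y'))"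
proof -
  define M where "M = 2 * int m"
  have M: "0 < M" using assms by (simp add: M_def)
  define q where "q = - (x div M)"
  define a u v w where "a = x + M * q" and "u = x' + M * q" and "v = y + M * q" and "w = y' + M * q"
  have a: "0 \<le> a" "a < M" using M by (auto simp: a_def q_def minus_mult_div_eq_mod)
  have less: "a < u" "u < v" "v < w" "w < a + M" using assms by (auto simp: a_def u_def v_def w_def M_def)
  have red: "t mod M = (if t < M then t else t - M)" if "0 \<le> t" "t < 2 * M" for t
  proof (cases "t < M")
    case False
    then have "t mod M = (t - M) mod M" by simp
    also have "\<dots> = t - M" using False that by (intro mod_pos_pos_trivial) auto
    finally show ?thesis using False by simp
  qed (use that in simp)
  have d: "diag m (x, y) = {nat a, nat (if v < M then v else v - M)}"
    using diag_shift[of m x q y] red[of a] red[of v] a less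
    by (simp add: diag_def a_def[symmetric] v_def[symmetric] M_def[symmetric])
  have e: "diag m (x', y') = {nat (if u < M then u else u - M), nat (if w < M then w else w - M)}"
    using diag_shift[of m x' q y'] red[of u] red[of w] a less
    by (simp add: diag_def u_def[symmetric] w_def[symmetric] M_def[symmetric])
  consider "w < M" | "v < M" "M \<le> w" | "u < M" "M \<le> v" | "M \<le> u" by linarith
  then show ?thesis
  proof cases
    case 1
    then show ?thesis unfolding d e using less a crosses_nat[of a u v w] by simp
  next
    case 2
    then show ?thesis unfolding d e using less a crosses_sym[OF crosses_nat[of "w - M" a u v]]
      by (simp add: insert_commute)
  next
    case 3
    then show ?thesis unfolding d e using less a crosses_nat[of "v - M" "w - M" a u]
      by (simp add: insert_commute)
  next
    case 4
    then show ?thesis unfolding d e using less a crosses_sym[OF crosses_nat[of "u - M" "v - M" "w - M" a]]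
      by (simp add: insert_commute)
  qed
qed

lemma crosses_diag_lift:
  assumes x: "x < y" "y < x + 2 * int m" and "0 < m" and cr: "crosses (diag m (x, y)) (diag m z)"
  obtains x' y' where "diag m (x', y') = diag m z" "x < x'" "x' < y" "y < y'" "y' < x + 2 * int m"
proof -
  define M where "M = 2 * int m"
  have bound: "a < 2 * m" if "a \<in> diag m w" for a w
    using that \<open>0 < m\<close> by (auto simp: diag_def nat_less_iff)
  have diag_nat: "diag m (int a, int b) = {a, b}" if "a < 2 * m" "b < 2 * m" for a b
  proof -
    have "int a mod (2 * int m) = int a" "int b mod (2 * int m) = int b" using that by auto
    then show ?thesis by (simp add: diag_def)
  qed
  obtain a b a' b' where ab: "a < a'" "a' < b" "b < b'"
      "diag m (x, y) = {a, b} \<and> diag m z = {a', b'} \<or> diag m (x, y) = {a', b'} \<and> diag m z = {a, b}"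
    using cr unfolding crosses_def by blast
  have lt: "b' < 2 * m" using ab(4) bound by blast
  then have M: "int b' < M" by (simp add: M_def)
  have dab: "diag m (int a, int b) = {a, b}" "diag m (int a', int b') = {a', b'}"
    using diag_nat ab lt by auto
  from ab(4) show ?thesis
  proof
    assume *: "diag m (x, y) = {a, b} \<and> diag m z = {a', b'}"
    consider q where "x = int a + M * q" "y = int b + M * q"
      | q where "x = int b + M * q" "y = int a + M + M * q"
      using diag_lifts[of "int a" "int b" m x y] * dab ab lt x unfolding M_def by auto
    then show ?thesis
    proof cases
      case 1
      then show ?thesis
        using that[of "int a' + M * q" "int b' + M * q"] * dab(2) ab M diag_shift[of m "int a'" q "int b'"]
        by (simp add: M_def)
    next
      case 2
      then show ?thesis
        using that[of "int b' + M * q" "int a' + M + M * q"] * dab(2) ab M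
          diag_shift[of m "int b'" q "int a' + M"] diag_swap[of m "int b'" "int a'"]
        by (simp add: M_def)
    qed
  next
    assume *: "diag m (x, y) = {a', b'} \<and> diag m z = {a, b}"
    consider q where "x = int a' + M * q" "y = int b' + M * q"
      | q where "x = int b' + M * q" "y = int a' + M + M * q"
      using diag_lifts[of "int a'" "int b'" m x y] * dab ab lt x unfolding M_def by auto
    then show ?thesis
    proof cases
      case 1
      then show ?thesis
        using that[of "int b + M * q" "int a + M + M * q"] * dab(1) ab M
          diag_shift[of m "int b" q "int a + M"] diag_swap[of m "int b" "int a"]
        by (simp add: M_def)
    next
      case 2
      then show ?thesis
        using that[of "int a + M * (q + 1)" "int b + M * (q + 1)"] * dab(1) ab M diag_shift[of m "int a" "q + 1" "int b"]
        by (simp add: M_def algebra_simps)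
    qed
  qed
qed

lemma central_symmetry_diag:
  assumes "0 < m"
  shows "central_symmetry m (diag m z) = diag m (z + (int m, int m))"
proof -
  have "(nat (t mod (2 * int m)) + m) mod (2 * m) = nat ((t + int m) mod (2 * int m))" for t
  proof -
    have "int ((nat (t mod (2 * int m)) + m) mod (2 * m)) = (t mod (2 * int m) + int m) mod (2 * int m)"
      using assms by (simp add: zmod_int)
    also have "\<dots> = (t + int m) mod (2 * int m)" by (simp add: mod_add_left_eq)
    finally show ?thesis by simp
  qed
  then show ?thesis by (simp add: central_symmetry_def diag_def)
qed

text \<open>There are \<open>y - x - 1\<close> vertices on one side and
  \<open>2m - 1 - (y - x)\<close> on the other, whence the strict bounds. For
  \<open>k = m - n\<close> they say that \<open>y - x = m + p\<close> with
  \<open>\<bar>p\<bar> < n\<close>, so relevant lengths correspond to walls.\<close>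

lemma relevant_diagonals_diag:
  assumes "k < m"
  shows "relevant_diagonals m k = {diag m (x, y) | x y. int k < y - x \<and> y - x < 2 * int m - int k}"
proof (intro equalityI subsetI)
  fix d assume "d \<in> relevant_diagonals m k"
  then obtain i j where d: "d = {i, j}" "i < j" "j < 2 * m" "k \<le> card {i<..<j}" "k \<le> card ({..<2 * m} - {i..j})"
    unfolding relevant_diagonals_def by blast
  have "card ({..<2 * m} - {i..j}) = 2 * m - (Suc j - i)"
    using d by (subst card_Diff_subset) auto
  then have "int k < int j - int i \<and> int j - int i < 2 * int m - int k" using d assms by auto
  moreover have "int i mod (2 * int m) = int i" "int j mod (2 * int m) = int j" using d by auto
  then have "d = diag m (int i, int j)" using d by (simp add: diag_def)
  ultimately show "d \<in> {diag m (x, y) | x y. int k < y - x \<and> y - x < 2 * int m - int k}" by blast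
next
  fix d assume "d \<in> {diag m (x, y) | x y. int k < y - x \<and> y - x < 2 * int m - int k}"
  then obtain x y where d: "d = diag m (x, y)" "int k < y - x" "y - x < 2 * int m - int k" by blast
  define M where "M = 2 * int m"
  have M: "0 < M" using assms by (simp add: M_def)
  define q where "q = - (x div M)"
  define a b where "a = x + M * q" and "b = y + M * q"
  have a: "0 \<le> a" "a < M" using M by (auto simp: a_def q_def minus_mult_div_eq_mod)
  have ab: "int k < b - a" "b - a < M - int k" using d by (auto simp: a_def b_def M_def)
  have dab: "d = diag m (a, b)" using d diag_shift[of m x q y] by (simp add: a_def b_def M_def)
  have mem: "{nat a', nat b'} \<in> relevant_diagonals m k"
    if "0 \<le> a'" "b' < M" "int k < b' - a'" "b' - a' < M - int k" for a' b'
  proof -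
    have "card ({..<2 * m} - {nat a'..nat b'}) = 2 * m - (Suc (nat b') - nat a')"
      using that by (subst card_Diff_subset) (auto simp: M_def nat_less_iff)
    then have "nat a' < nat b' \<and> nat b' < 2 * m \<and> k \<le> card {nat a'<..<nat b'} \<and>
        k \<le> card ({..<2 * m} - {nat a'..nat b'})"
      using that by (simp add: M_def nat_less_iff) linarith
    then show ?thesis unfolding relevant_diagonals_def by blast
  qed
  show "d \<in> relevant_diagonals m k"
  proof (cases "b < M")
    case True
    then have "a mod M = a" "b mod M = b" using a ab by auto
    then have "d = {nat a, nat b}" using dab by (simp add: diag_def M_def)
    then show ?thesis using mem[of a b] a ab True by simp
  next
    case False
    then have "a mod M = a" "b mod M = b - M"
      using a ab mod_pos_pos_trivial[of "b - M" M] by auto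
    then have "d = {nat (b - M), nat a}" using dab by (auto simp: diag_def M_def)
    then show ?thesis using mem[of "b - M" a] a ab False by simp
  qed
qed

lemma eq_0_if_abs_mult_less:
  assumes "- (2 * int m) < 2 * int m * q" "2 * int m * q < 2 * int m"
  shows "q = 0"
proof -
  have "2 * int m * (- 1) < 2 * int m * q" "2 * int m * q < 2 * int m * 1" using assms by auto
  moreover have "0 < 2 * int m" using assms by linarith
  ultimately have "- 1 < q" "q < 1" by (metis mult_less_cancel_left_pos)+
  then show ?thesis by simp
qed

section \<open>Slots as lifts of relevant diagonals\<close>

context coxeter_word
begin

lemma slot_rotate: "(snd (slot m p r), fst (slot m p r) + 2 * int m) = slot m (- p) (r + int m)"
  by (simp add: slot_def)

lemma slot_translate: "slot m p r + (t, t) = slot m p (r + t)"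
  by (simp add: slot_def)

lemma diag_slot_rotate: "diag m (slot m (- p) (r + int m)) = diag m (slot m p r)"
  using diag_swap[of m "snd (slot m p r)" "fst (slot m p r)"] by (simp add: slot_rotate)

lemma diag_slot_reduce: "diag m (slot m p (r + int m)) = diag m (slot m (- p) r)"
  using diag_slot_rotate[of m "- p" r] by simp

lemma slot_strip:
  assumes "\<bar>p\<bar> < int n" "n \<le> m"
  shows "fst (slot m p r) < snd (slot m p r)" "snd (slot m p r) < fst (slot m p r) + 2 * int m"
  using slot_diff[of m p r] assms by linarith+

lemma slot_lifts:
  assumes "n \<le> m" "\<bar>p\<bar> < int n" "x < y" "y < x + 2 * int m" "diag m (x, y) = diag m (slot m p r)"
  shows "\<exists>q. (x, y) = slot m p (r + 2 * int m * q) \<or>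
    (x, y) = slot m (- p) (r + int m + 2 * int m * q)"
proof -
  define u v where "u = fst (slot m p r)" and "v = snd (slot m p r)"
  have uv: "slot m p r = (u, v)" by (simp add: u_def v_def)
  have "u < v" "v < u + 2 * int m" using slot_strip[OF assms(2,1), of r] by (auto simp: u_def v_def)
  moreover have "diag m (u, v) = diag m (x, y)" using assms(5) uv by simp
  ultimately consider q where "x = u + 2 * int m * q" "y = v + 2 * int m * q"
    | q where "x = v + 2 * int m * q" "y = u + 2 * int m + 2 * int m * q"
    using diag_lifts[of u v m x y] assms(3,4) by blast
  then show ?thesis
  proof cases
    case 1
    then have "(x, y) = slot m p r + (2 * int m * q, 2 * int m * q)" using uv by simp
    then show ?thesis unfolding slot_translate by blast
  next
    case 2
    have "slot m (- p) (r + int m) = (v, u + 2 * int m)" using slot_rotate[of m p r] uv by simp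
    then have "(x, y) = slot m (- p) (r + int m) + (2 * int m * q, 2 * int m * q)" using 2 by simp
    then show ?thesis unfolding slot_translate by blast
  qed
qed

text \<open>Lifts of one diagonal differ by multiples of \<open>m\<close> in their rounds, so the
  rounds \<open>0, \<dots>, m - 1\<close> contain at most one of them.\<close>

lemma diag_slot_inj:
  assumes "n \<le> m" "\<bar>p\<bar> < int n" "\<bar>p'\<bar> < int n" "0 \<le> r" "r < int m" "0 \<le> r'" "r' < int m"
    and eq: "diag m (slot m p r) = diag m (slot m p' r')"
  shows "p = p' \<and> r = r'"
proof -
  have "fst (slot m p r) < snd (slot m p r)" "snd (slot m p r) < fst (slot m p r) + 2 * int m"
    using slot_strip assms by auto
  moreover have "diag m (fst (slot m p r), snd (slot m p r)) = diag m (slot m p' r')" using eq by simp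
  ultimately consider q where "slot m p r = slot m p' (r' + 2 * int m * q)"
    | q where "slot m p r = slot m (- p') (r' + int m + 2 * int m * q)"
    using slot_lifts[OF assms(1,3), of "fst (slot m p r)" "snd (slot m p r)" r'] by auto
  then show ?thesis
  proof cases
    case 1
    then have *: "p = p'" "r = r' + 2 * int m * q" by (auto simp: slot_eq_iff)
    then have "q = 0" using assms by (intro eq_0_if_abs_mult_less[of m]) linarith+
    then show ?thesis using * by simp
  next
    case 2
    then have *: "r = r' + int m + 2 * int m * q" by (auto simp: slot_eq_iff)
    then have "q = 0" using assms by (intro eq_0_if_abs_mult_less[of m]) linarith+
    then show ?thesis using * assms by simp
  qed
qed

text \<open>The interleaving lift \<open>(x, y)\<close> of the second diagonal lies between
  \<open>z\<close> and the half turn of \<open>z\<close>, so its round lies between \<open>r\<close>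
  and \<open>r + m\<close>. This leaves \<open>z'\<close> and the half turn of \<open>z'\<close>;
  the former puts \<open>z\<close> below \<open>z'\<close>, the latter above.\<close>

lemma slot_comparable_if_crosses:
  assumes "n \<le> m" "\<bar>p\<bar> < int n" "\<bar>p'\<bar> < int n" "0 \<le> r" "r < int m" "0 \<le> r'" "r' < int m"
    and cr: "crosses (diag m (slot m p r)) (diag m (slot m p' r'))"
  defines "z \<equiv> slot m p r" and "z' \<equiv> slot m p' r'"
  shows "fst z < fst z' \<and> snd z < snd z' \<or> fst z' < fst z \<and> snd z' < snd z"
    and "fst z < snd z'" "snd z < fst z' + 2 * int m"
proof -
  have strip: "fst z < snd z" "snd z < fst z + 2 * int m" "fst z' < snd z'" "snd z' < fst z' + 2 * int m"
    unfolding z_def z'_def using slot_strip assms by auto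
  have "0 < m" using assms(5,4) by linarith
  obtain x y where xy: "diag m (x, y) = diag m z'" "fst z < x" "x < snd z" "snd z < y" "y < fst z + 2 * int m"
    using crosses_diag_lift[of "fst z" "snd z" m z'] strip cr \<open>0 < m\<close> unfolding z_def z'_def by auto
  then have xy': "x < y" "y < x + 2 * int m" using strip by linarith+
  have le: "r \<le> s \<and> s \<le> r + int m" if s: "(x, y) = slot m p'' s" for p'' s
  proof
    have eqs: "fst (slot m p'' s) = x" "snd (slot m p'' s) = y"
        "fst (slot m (- p) (r + int m)) = snd z" "snd (slot m (- p) (r + int m)) = fst z + 2 * int m"
      using s[symmetric] by (simp_all add: slot_rotate[symmetric] z_def)
    show "r \<le> s" using xy slot_le_rounds[of m p r p'' s] eqs unfolding z_def by linarith
    show "s \<le> r + int m"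
      using xy slot_le_rounds[of m p'' s "- p" "r + int m"] eqs by linarith
  qed
  consider q where "(x, y) = slot m p' (r' + 2 * int m * q)"
    | q where "(x, y) = slot m (- p') (r' + int m + 2 * int m * q)"
    using slot_lifts[OF assms(1,3) xy'] xy(1) unfolding z'_def by blast
  then have "(x, y) = z' \<or> (x, y) = (snd z', fst z' + 2 * int m)"
  proof cases
    case 1
    then have "q = 0" using le[OF 1] assms by (intro eq_0_if_abs_mult_less[of m]) linarith+
    then show ?thesis using 1 by (simp add: z'_def)
  next
    case 2
    then have "q = 0" using le[OF 2] assms by (intro eq_0_if_abs_mult_less[of m]) linarith+
    then show ?thesis using 2 slot_rotate[of m p' r'] by (simp add: z'_def)
  qed
  then show "fst z < fst z' \<and> snd z < snd z' \<or> fst z' < fst z \<and> snd z' < snd z"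
      "fst z < snd z'" "snd z < fst z' + 2 * int m"
    using xy strip by auto
qed

lemma inj_on_diag_slots: "n \<le> m \<Longrightarrow> inj_on (diag m) (slots m P)"
proof (rule inj_onI)
  fix c d assume nm: "n \<le> m" and c: "c \<in> slots m P" and d: "d \<in> slots m P" and eq: "diag m c = diag m d"
  obtain p r where "c = slot m p r" "\<bar>p\<bar> < int n" "0 \<le> r" "r < int m"
    using slots_elim[OF c] by blast
  moreover obtain p' r' where "d = slot m p' r'" "\<bar>p'\<bar> < int n" "0 \<le> r'" "r' < int m"
    using slots_elim[OF d] by blast
  ultimately show "c = d" using diag_slot_inj[OF nm, of p p' r r'] eq by simp
qed

lemma is_crossing_iff_slot_chain:
  assumes nm: "n \<le> m"
  shows "(\<exists>X\<subseteq>diag m ` slots m P. is_crossing l X) \<longleftrightarrow>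
    (\<exists>Z\<subseteq>slots m P. slot_chain m Z \<and> card Z = l)"
proof
  assume "\<exists>X\<subseteq>diag m ` slots m P. is_crossing l X"
  then obtain X where X: "X \<subseteq> diag m ` slots m P" "finite X" "card X = l" "pairwise crosses X"
    unfolding is_crossing_def by blast
  define Z where "Z = {z \<in> slots m P. diag m z \<in> X}"
  have inj: "inj_on (diag m) Z"
    using inj_on_diag_slots[OF nm] by (rule inj_on_subset) (auto simp: Z_def)
  have im: "diag m ` Z = X" using X(1) by (auto simp: Z_def)
  have "card Z = l" using card_image[OF inj] im X(3) by simp
  moreover have "finite Z" using inj im X(2) finite_imageD by blast
  moreover have "(c \<noteq> d \<longrightarrow> fst c < fst d \<and> snd c < snd d \<or> fst d < fst c \<and> snd d < snd c) \<and>
      fst d < snd c \<and> snd d < fst c + 2 * int m" if cd: "c \<in> Z" "d \<in> Z" for c d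
  proof -
    have mem: "c \<in> slots m P" "d \<in> slots m P" using cd by (auto simp: Z_def)
    obtain p r where pr: "c = slot m p r" "\<bar>p\<bar> < int n" "0 \<le> r" "r < int m"
      using slots_elim[OF mem(1)] by blast
    obtain p' r' where pr': "d = slot m p' r'" "\<bar>p'\<bar> < int n" "0 \<le> r'" "r' < int m"
      using slots_elim[OF mem(2)] by blast
    show ?thesis
    proof (cases "c = d")
      case True
      then show ?thesis using slot_strip[of p m r] pr nm by simp
    next
      case False
      then have "diag m d \<noteq> diag m c" using inj cd by (auto simp: inj_on_def)
      then have "crosses (diag m d) (diag m c)"
        using X(4) cd unfolding pairwise_def Z_def by auto
      then show ?thesis using slot_comparable_if_crosses[OF nm pr'(2) pr(2) pr'(3,4) pr(3,4)] pr(1) pr'(1) by auto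
    qed
  qed
  ultimately have "slot_chain m Z" unfolding slot_chain_def by blast
  then show "\<exists>Z\<subseteq>slots m P. slot_chain m Z \<and> card Z = l"
    using \<open>card Z = l\<close> by (intro exI[of _ Z]) (auto simp: Z_def)
next
  assume "\<exists>Z\<subseteq>slots m P. slot_chain m Z \<and> card Z = l"
  then obtain Z where Z: "Z \<subseteq> slots m P" "slot_chain m Z" "card Z = l" by blast
  have "is_crossing l (diag m ` Z)"
    unfolding is_crossing_def
  proof (intro conjI pairwiseI)
    show "finite (diag m ` Z)" using Z by (simp add: slot_chain_def)
    show "card (diag m ` Z) = l"
      using card_image[OF inj_on_subset[OF inj_on_diag_slots[OF nm] Z(1)]] Z(3) by simp
    have cr: "crosses (diag m c) (diag m d)" if "c \<in> Z" "d \<in> Z" "fst c < fst d \<and> snd c < snd d" for c d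
      using crosses_diag[of "fst c" "fst d" "snd c" "snd d" m] that Z(2)
      by (simp add: slot_chain_def)
    fix x y assume "x \<in> diag m ` Z" "y \<in> diag m ` Z" "x \<noteq> y"
    then obtain c d where "x = diag m c" "y = diag m d" "c \<in> Z" "d \<in> Z" "c \<noteq> d" by blast
    moreover have "fst c < fst d \<and> snd c < snd d \<or> fst d < fst c \<and> snd d < snd c"
      using Z(2) \<open>c \<in> Z\<close> \<open>d \<in> Z\<close> \<open>c \<noteq> d\<close> unfolding slot_chain_def by blast
    ultimately show "crosses x y" using cr crosses_sym by blast
  qed
  then show "\<exists>X\<subseteq>diag m ` slots m P. is_crossing l X" using Z(1) by blast
qed

text \<open>Central symmetry adds \<open>m\<close> to the round, which amounts to negating the wall,
  so the two walls of a letter give a symmetric pair. The letter 0 gives the diameters.\<close>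

definition position_pair :: "nat \<Rightarrow> nat \<Rightarrow> nat set set" where
  "position_pair m j =
     {diag m (slot m (int (cw ! (j mod n))) (int (j div n))),
      diag m (slot m (- int (cw ! (j mod n))) (int (j div n)))}"

lemma Union_position_pair:
  assumes "P \<subseteq> {..<n * m}"
  shows "\<Union> (position_pair m ` P) = diag m ` slots m P"
proof -
  have "\<bar>p\<bar> = int i \<longleftrightarrow> p = int i \<or> p = - int i" for p i by auto
  then have "position_pair m j = {diag m (slot m p (int (j div n))) | p. \<bar>p\<bar> = int (cw ! (j mod n))}" for j
    unfolding position_pair_def by auto
  then have "\<Union> (position_pair m ` P) =
      {diag m (slot m p (int (j div n))) | j p. j \<in> P \<and> \<bar>p\<bar> = int (cw ! (j mod n))}"
    by blast
  moreover have "slots m P = {slot m p (int (j div n)) | j p. j \<in> P \<and> \<bar>p\<bar> = int (cw ! (j mod n))}"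
    unfolding slots_def using assms by (intro Collect_cong) blast
  moreover have "f ` {g j p | j p. R j p} = {f (g j p) | j p. R j p}"
    for f :: "int \<times> int \<Rightarrow> nat set" and g :: "nat \<Rightarrow> int \<Rightarrow> int \<times> int" and R
    by blast
  ultimately show ?thesis by (simp only:)
qed

lemma bij_position_pair:
  assumes nm: "n \<le> m" and n: "0 < n"
  shows "bij_betw (position_pair m) {..<n * m} (symmetric_pairs m (m - n))"
proof (rule bij_betwI')
  have m: "0 < m" using nm n by simp
  have letter: "\<bar>int (cw ! (j mod n))\<bar> < int n" for j using nth_less[of "j mod n"] n by simp
  have round: "int (j div n) < int m" if "j < n * m" for j
    using that by (simp add: less_mult_imp_div_less mult.commute)
  have km: "m - n < m" using nm n by simp
  have strip: "int (m - n) < y - x \<and> y - x < 2 * int m - int (m - n) \<longleftrightarrow> \<bar>y - x - int m\<bar> < int n" for x y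
    using nm by auto
  have rel: "relevant_diagonals m (m - n) = {diag m (slot m p r) | p r. \<bar>p\<bar> < int n}"
  proof -
    have "(x, y) = slot m (y - x - int m) (x - shift (y - x - int m))" for x y
      using shift_minus[of "y - x - int m"] by (simp add: slot_def)
    then have "\<exists>p r. diag m (x, y) = diag m (slot m p r) \<and> \<bar>p\<bar> < int n" if "\<bar>y - x - int m\<bar> < int n" for x y
      using that by metis
    moreover have "\<exists>x y. diag m (slot m p r) = diag m (x, y) \<and> \<bar>y - x - int m\<bar> < int n" if "\<bar>p\<bar> < int n" for p r
      using that slot_diff[of m p r] by (metis prod.collapse)
    ultimately show ?thesis
      unfolding relevant_diagonals_diag[OF km] strip by blast
  qed
  have central: "central_symmetry m (diag m (slot m p r)) = diag m (slot m (- p) r)" for p r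
    using central_symmetry_diag[OF m, of "slot m p r"] by (simp add: slot_translate diag_slot_reduce)
  have "symmetric_pairs m (m - n) =
      {{diag m (slot m p r), central_symmetry m (diag m (slot m p r))} | p r. \<bar>p\<bar> < int n}"
    unfolding symmetric_pairs_def rel by blast
  then have pairs: "symmetric_pairs m (m - n) =
      {{diag m (slot m p r), diag m (slot m (- p) r)} | p r. \<bar>p\<bar> < int n}"
    by (simp only: central)
  {
    fix j j' assume j: "j \<in> {..<n * m}" and j': "j' \<in> {..<n * m}"
    show "position_pair m j = position_pair m j' \<longleftrightarrow> j = j'"
    proof
      assume "position_pair m j = position_pair m j'"
      then have "diag m (slot m (int (cw ! (j mod n))) (int (j div n))) \<in> position_pair m j'"
        by (auto simp: position_pair_def)
      then obtain p where p: "\<bar>p\<bar> = int (cw ! (j' mod n))"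
          "diag m (slot m (int (cw ! (j mod n))) (int (j div n))) = diag m (slot m p (int (j' div n)))"
        by (force simp: position_pair_def)
      have "\<bar>p\<bar> < int n" using p(1) letter[of j'] by simp
      then have "int (cw ! (j mod n)) = p \<and> int (j div n) = int (j' div n)"
        using diag_slot_inj[OF nm letter[of j] _ _ round _ round p(2)] j j' by simp
      then have "cw ! (j mod n) = cw ! (j' mod n)" and div: "j div n = j' div n" using p(1) by auto
      moreover have "pos (cw ! (j mod n)) = j mod n" "pos (cw ! (j' mod n)) = j' mod n"
        using n by (simp_all add: pos_nth)
      ultimately have "j mod n = j' mod n" by metis
      then have "j div n * n + j mod n = j' div n * n + j' mod n" using div by (simp only:)
      then show "j = j'" unfolding div_mult_mod_eq .
    qed simp
  next
    fix j
    show "position_pair m j \<in> symmetric_pairs m (m - n)"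
      unfolding pairs position_pair_def using letter[of j] by blast
  next
    fix S assume "S \<in> symmetric_pairs m (m - n)"
    then obtain p r where S: "\<bar>p\<bar> < int n" "S = {diag m (slot m p r), diag m (slot m (- p) r)}"
      unfolding pairs by blast
    \<comment> \<open>Changing the round by \<open>m\<close> swaps the diagonals of a pair, so the
      round can be reduced modulo \<open>m\<close>.\<close>
    have shift: "{diag m (slot m p (r + int m * int t)), diag m (slot m (- p) (r + int m * int t))} =
        {diag m (slot m p r), diag m (slot m (- p) r)}" for r t
    proof (induction t)
      case (Suc t)
      have "r + int m * int (Suc t) = r + int m * int t + int m" by (simp add: algebra_simps)
      then show ?case
        unfolding Suc.IH[symmetric] by (simp only: diag_slot_reduce minus_minus insert_commute)
    qed simp
    define r0 where "r0 = r mod int m"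
    have r0: "0 \<le> r0" "r0 < int m" using m by (auto simp: r0_def)
    obtain t where "r = r0 + int m * int t \<or> r0 = r + int m * int t"
    proof (cases "0 \<le> r div int m")
      case True
      then show ?thesis using that[of "nat (r div int m)"] by (simp add: r0_def)
    next
      case False
      then show ?thesis using that[of "nat (- (r div int m))"]
        by (simp add: r0_def minus_mult_div_eq_mod)
    qed
    then have S0: "S = {diag m (slot m p r0), diag m (slot m (- p) r0)}"
    proof
      assume r: "r = r0 + int m * int t"
      show ?thesis unfolding S(2) r by (rule shift)
    next
      assume r: "r0 = r + int m * int t"
      show ?thesis unfolding S(2) r by (rule shift[symmetric])
    qed
    define l where "l = pos (nat \<bar>p\<bar>)"
    have l: "l < n" "cw ! l = nat \<bar>p\<bar>" using pos_less nth_pos S(1) by (auto simp: l_def nat_less_iff)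
    define j where "j = n * nat r0 + l"
    have "nat r0 < m" using r0 by (simp add: nat_less_iff)
    then have "n * nat r0 + n \<le> n * m" by (metis Suc_leI add.commute mult_Suc_right mult_le_mono2)
    then have "j < n * m" using l by (simp add: j_def)
    moreover have "j mod n = l" "int (j div n) = r0" using l r0 by (auto simp: j_def)
    then have "position_pair m j = {diag m (slot m \<bar>p\<bar> r0), diag m (slot m (- \<bar>p\<bar>) r0)}"
      using l by (simp add: position_pair_def)
    then have "position_pair m j = S" using S0 by (auto simp: abs_if insert_commute)
    ultimately show "\<exists>j\<in>{..<n * m}. S = position_pair m j" by auto
  }
qed

end

section \<open>The criterion for faces, and the word \<open>c^n\<close>\<close>

context coxeter_word
begin

lemma Q_contains_opposite_iff:
  assumes nm: "n \<le> m"
  shows "(\<exists>u. subseq u (nths (Q m) (- P)) \<and> length u = n * n \<and> perm_B u = opposite n) \<longleftrightarrow>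
    \<not> (\<exists>Z\<subseteq>slots m P. slot_chain m Z \<and> card Z = Suc (m - n))"
proof -
  define v where "v = nths (Q m) (- P)"
  have v: "v \<in> lists {..<n}" using Q_lists[of m] set_nths_subset[of "Q m" "- P"] by (auto simp: v_def)
  have heights: "heights m P h (n * m) = foldl height_step h v" for h
    by (simp add: heights_def v_def length_Q flip: length_Q)
  show ?thesis unfolding v_def[symmetric]
  proof (intro iffI notI)
    assume "\<exists>u. subseq u v \<and> length u = n * n \<and> perm_B u = opposite n"
    then obtain u where u: "subseq u v" "perm_B u = opposite n" by blast
    assume "\<exists>Z\<subseteq>slots m P. slot_chain m Z \<and> card Z = Suc (m - n)"
    then obtain Z where "Z \<subseteq> slots m P" "slot_chain m Z" "card Z = Suc (m - n)" by blast
    then obtain p where p: "\<bar>p\<bar> < int n" "foldl height_step (height n (- p) id) v p < int n - p"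
      using low_if_slot_chain[OF nm, of Z P] unfolding heights by blast
    have "height n (- p) (opposite n) p \<le> foldl height_step (height n (- p) id) v p"
      using height_subword_le[OF u(1) v, of "- p" id "height n (- p) id" p] by (simp add: u(2))
    then show False using p height_opposite[of p n] by simp
  next
    assume no: "\<not> (\<exists>Z\<subseteq>slots m P. slot_chain m Z \<and> card Z = Suc (m - n))"
    define x where "x = foldl demazure_step id v"
    have sym: "sym_perm n x" unfolding x_def by (rule sym_perm_demazure[OF sym_perm_id v])
    have "x = opposite n"
    proof (rule opposite_if_heights[OF sym])
      fix p assume p: "\<bar>p\<bar> < int n"
      have "height n (- p) x p = heights m P (height n (- p) id) (n * m) p"
        unfolding x_def heights height_demazure[OF sym_perm_id v] ..
      then show "int n - p \<le> height n (- p) x p"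
        using slot_chain_if_low[OF nm p, of P] no by force
    qed
    moreover obtain u where "subseq u v" "id \<circ> perm_B u = x" "inv_count n x = inv_count n id + 2 * int (length u)"
      using demazure_subword[OF sym_perm_id v] unfolding x_def by blast
    moreover have "int (length u) = int (n * n)" if "inv_count n (opposite n) = inv_count n id + 2 * int (length u)" for u :: "nat list"
      using that unfolding inv_count_opposite inv_count_id by linarith
    ultimately show "\<exists>u. subseq u v \<and> length u = n * n \<and> perm_B u = opposite n"
      by (metis id_comp of_nat_eq_iff)
  qed
qed

text \<open>In the case \<open>m = n\<close> without deletions there is no chain of one point, so
  \<open>c^n\<close> contains a word of length \<open>n * n\<close> for the reversal. Having just
  \<open>n * n\<close> letters, it is that word.\<close>

lemma perm_B_Q: "perm_B (Q n) = opposite n"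
proof -
  have "slots n {} = {}" by (simp add: slots_def)
  then have "\<not> (\<exists>Z\<subseteq>slots n {}. slot_chain n Z \<and> card Z = Suc (n - n))" by auto
  then obtain u where "subseq u (nths (Q n) (- {}))" "length u = n * n" "perm_B u = opposite n"
    using Q_contains_opposite_iff[of n "{}"] by auto
  then show ?thesis using length_Q[of n] by (auto simp: nths_all dest: subseq_same_length)
qed

end

section \<open>The Coxeter group\<close>

locale type_B_system =
  fixes G :: "('a, 'b) monoid_scheme" (structure) and s :: "nat \<Rightarrow> 'a" and n :: nat
  assumes system: "coxeter_system G {..<n} s coxeter_matrix_B"
begin

sublocale group G
  using system by (simp add: coxeter_system_def)

abbreviation I :: "nat set" where "I \<equiv> {..<n}"

lemma gen_closed: "i \<in> I \<Longrightarrow> s i \<in> carrier G"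
  using system by (auto simp: coxeter_system_def)

lemma word_prod_eq_iff:
  "u \<in> lists I \<Longrightarrow> v \<in> lists I \<Longrightarrow> word_prod G s u = word_prod G s v \<longleftrightarrow> equiv_B n u v"
  using system by (simp add: coxeter_system_def)

lemma word_prod_Cons: "word_prod G s (i # u) = s i \<otimes> word_prod G s u"
  by (simp add: word_prod_def)

lemma word_prod_closed: "u \<in> lists I \<Longrightarrow> word_prod G s u \<in> carrier G"
  by (induction u) (auto simp: word_prod_def gen_closed)

lemma word_prod_append:
  "u \<in> lists I \<Longrightarrow> v \<in> lists I \<Longrightarrow> word_prod G s (u @ v) = word_prod G s u \<otimes> word_prod G s v"
proof (induction u)
  case Nil
  then show ?case using word_prod_closed[of v] by (simp add: word_prod_def)
next
  case (Cons i u)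
  then show ?case
    using word_prod_closed[of u] word_prod_closed[of v] gen_closed[of i]
    by (simp add: word_prod_Cons m_assoc)
qed

lemma carrier_word:
  assumes "y \<in> carrier G"
  shows "\<exists>u\<in>lists I. word_prod G s u = y"
proof -
  have "y \<in> generate G (s ` I)" using assms system by (simp add: coxeter_system_def)
  then show ?thesis
  proof (induction rule: generate.induct)
    case one
    show ?case by (intro bexI[of _ "[]"]) (auto simp: word_prod_def)
  next
    case (incl h)
    then obtain i where "i \<in> I" "h = s i" by auto
    then show ?case using gen_closed[of i] by (intro bexI[of _ "[i]"]) (auto simp: word_prod_def)
  next
    case (inv h)
    then obtain i where i: "i \<in> I" "h = s i" by auto
    have "word_prod G s [i, i] = word_prod G s []"
      using word_prod_eq_iff[of "[i, i]" "[]"] equiv_B_square[of i n "[]" "[]"] i by simp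
    then have "s i \<otimes> s i = \<one>" using gen_closed[OF i(1)] by (simp add: word_prod_def)
    then have "inv h = s i" using gen_closed[OF i(1)] i by (simp add: inv_equality)
    then show ?case using gen_closed[OF i(1)] i by (intro bexI[of _ "[i]"]) (auto simp: word_prod_def)
  next
    case (eng g h)
    then obtain u v where "u \<in> lists I" "word_prod G s u = g" "v \<in> lists I" "word_prod G s v = h" by blast
    then show ?case by (intro bexI[of _ "u @ v"]) (auto simp: word_prod_append)
  qed
qed

lemma coxeter_length_le: "u \<in> lists I \<Longrightarrow> coxeter_length G I s (word_prod G s u) \<le> length u"
  unfolding coxeter_length_def by (rule Least_le) blast

lemma coxeter_length_word:
  assumes "y \<in> carrier G"
  obtains u where "u \<in> lists I" "word_prod G s u = y" "length u = coxeter_length G I s y"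
proof -
  have "\<exists>l. \<exists>w\<in>lists I. length w = l \<and> word_prod G s w = y" using carrier_word[OF assms] by blast
  from LeastI_ex[OF this] show ?thesis using that unfolding coxeter_length_def by blast
qed

lemma coxeter_length_carrier:
  assumes "y \<in> carrier G"
  shows "coxeter_length G I s y \<le> n * n"
    and "coxeter_length G I s y = n * n \<Longrightarrow> y = word_prod G s (longest_normal_word n)"
proof -
  obtain u where u: "u \<in> lists I" "word_prod G s u = y" using carrier_word[OF assms] by blast
  obtain w where w: "w \<in> normal_words n" "equiv_B n u w" using equiv_normal_word[OF u(1)] by blast
  have wI: "w \<in> lists I" by (rule normal_words_lists[OF w(1)])
  have y: "word_prod G s w = y" using word_prod_eq_iff[OF u(1) wI] w(2) u(2) by simp
  note l = coxeter_length_le[OF wI, unfolded y] normal_words_length[OF w(1)]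
  show "coxeter_length G I s y \<le> n * n" using l by linarith
  show "y = word_prod G s (longest_normal_word n)" if "coxeter_length G I s y = n * n"
    using l that y by auto
qed

text \<open>The lower bound by inversions and the upper bound by normal words meet at
  \<open>n * n\<close>, where a single normal word is left. So all words acting as the reversal
  represent the same group element.\<close>

lemma opposite_word:
  assumes "w \<in> lists I" "perm_B w = opposite n"
  shows "coxeter_length G I s (word_prod G s w) = n * n"
    and "word_prod G s w = word_prod G s (longest_normal_word n)"
proof -
  have c: "word_prod G s w \<in> carrier G" by (rule word_prod_closed[OF assms(1)])
  obtain u where u: "u \<in> lists I" "word_prod G s u = word_prod G s w"
      "length u = coxeter_length G I s (word_prod G s w)"
    using coxeter_length_word[OF c] by blast
  have "perm_B u = opposite n"
    using perm_B_cong word_prod_eq_iff[OF u(1) assms(1)] u(2) assms(2) by metis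
  then have "n * n \<le> length u" by (rule length_ge_if_opposite[OF u(1)])
  then show l: "coxeter_length G I s (word_prod G s w) = n * n"
    using coxeter_length_carrier(1)[OF c] u(3) by simp
  show "word_prod G s w = word_prod G s (longest_normal_word n)"
    by (rule coxeter_length_carrier(2)[OF c l])
qed

lemma longest_element_eq:
  assumes "w \<in> lists I" "perm_B w = opposite n"
  shows "longest_element G I s = word_prod G s w"
  unfolding longest_element_def
proof (rule the_equality)
  show "word_prod G s w \<in> carrier G \<and>
      (\<forall>y\<in>carrier G. coxeter_length G I s y \<le> coxeter_length G I s (word_prod G s w))"
    using word_prod_closed[OF assms(1)] opposite_word(1)[OF assms] coxeter_length_carrier(1) by simp
next
  fix x assume x: "x \<in> carrier G \<and> (\<forall>y\<in>carrier G. coxeter_length G I s y \<le> coxeter_length G I s x)"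
  then have "n * n \<le> coxeter_length G I s x"
    using word_prod_closed[OF assms(1)] opposite_word(1)[OF assms] by metis
  then have "coxeter_length G I s x = n * n" using coxeter_length_carrier(1)[of x] x by simp
  then show "x = word_prod G s w" using coxeter_length_carrier(2)[of x] x opposite_word(2)[OF assms] by simp
qed

lemma reduced_word_longest_iff:
  assumes "w \<in> lists I" "perm_B w = opposite n"
  shows "reduced_word G I s u (word_prod G s w) \<longleftrightarrow> u \<in> lists I \<and> length u = n * n \<and> perm_B u = opposite n"
proof
  assume "reduced_word G I s u (word_prod G s w)"
  then have u: "u \<in> lists I" "word_prod G s u = word_prod G s w" "length u = n * n"
    using opposite_word(1)[OF assms] by (auto simp: reduced_word_def)
  then have "perm_B u = opposite n"
    using perm_B_cong word_prod_eq_iff[OF u(1) assms(1)] assms(2) by metis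
  then show "u \<in> lists I \<and> length u = n * n \<and> perm_B u = opposite n" using u by simp
next
  assume u: "u \<in> lists I \<and> length u = n * n \<and> perm_B u = opposite n"
  then show "reduced_word G I s u (word_prod G s w)"
    using opposite_word[OF assms] opposite_word(2)[of u] by (simp add: reduced_word_def)
qed

text \<open>A Coxeter element has a word of length \<open>n\<close>, and its reduced words use all
  \<open>n\<close> letters; hence each letter occurs exactly once.\<close>

lemma coxeter_word_if_reduced:
  assumes "coxeter_element G I s c" "reduced_word G I s cw c"
  shows "coxeter_word n cw"
proof -
  obtain w where w: "distinct w" "set w = I" "word_prod G s w = c"
    using assms(1) by (auto simp: coxeter_element_def)
  have cw: "cw \<in> lists I" "word_prod G s cw = c" "length cw = coxeter_length G I s c"
    using assms(2) by (auto simp: reduced_word_def)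
  have wI: "w \<in> lists I" using w(2) by auto
  have "length w = n" using distinct_card[OF w(1)] w(2) by simp
  then have "length cw \<le> n" using coxeter_length_le[OF wI] w(3) cw(3) by simp
  have "perm_B cw = perm_B w"
    using perm_B_cong word_prod_eq_iff[OF cw(1) wI] w(3) cw(2) by metis
  then have "I \<subseteq> set cw" using letter_mem_if_perm_B_eq[OF w(1)] w(2) by blast
  then have set: "set cw = I" using cw(1) by auto
  then have "n \<le> length cw" using card_length[of cw] by simp
  then show ?thesis using set \<open>length cw \<le> n\<close> by (simp add: coxeter_word_def)
qed

end

section \<open>The sorting word of the longest element, and the isomorphism\<close>

lemma strictly_sorted_lexord_least:
  fixes qs :: "nat list"
  assumes "sorted_wrt (<) qs"
  shows "[0..<length qs] = qs \<or> ([0..<length qs], qs) \<in> lexord less_than"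
proof (cases "\<forall>i<length qs. qs ! i = i")
  case True
  then show ?thesis by (intro disjI1 nth_equalityI) simp_all
next
  case False
  define i where "i = (LEAST i. i < length qs \<and> qs ! i \<noteq> i)"
  have i: "i < length qs \<and> qs ! i \<noteq> i" unfolding i_def by (rule LeastI_ex) (use False in blast)
  have less: "qs ! j = j" if "j < i" for j
    using not_less_Least[of j "\<lambda>i. i < length qs \<and> qs ! i \<noteq> i"] that i by (auto simp: i_def)
  \<comment> \<open>Strict increase keeps entry \<open>j\<close> at or above \<open>j\<close>, so
    the initial segment is smaller at the first disagreement.\<close>
  have ge: "j < length qs \<Longrightarrow> j \<le> qs ! j" for j
  proof (induction j)
    case (Suc j)
    then have "qs ! j < qs ! Suc j" using assms by (simp add: sorted_wrt_iff_nth_less)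
    then show ?case using Suc by simp
  qed simp
  have "take i [0..<length qs] = take i qs"
    using less i by (intro nth_equalityI) simp_all
  then show ?thesis
    unfolding lexord_take_index_conv using i ge[of i] by (intro disjI2) (auto intro!: exI[of _ i])
qed

lemma (in type_B_system) sorting_word_longest:
  assumes cw: "coxeter_word n cw"
  shows "sorting_word G I s cw (longest_element G I s) = concat (replicate n cw)"
proof -
  interpret coxeter_word n cw by (rule cw)
  have w: "Q n \<in> lists I" "perm_B (Q n) = opposite n" using Q_lists perm_B_Q by auto
  note longest = longest_element_eq[OF w]
  have map: "map (periodic_letter cw) [0..<n * n] = Q n"
    by (rule nth_equalityI) (auto simp: length_Q nth_Q periodic_letter_def length_cw)
  let ?R = "reduced_positions G I s cw (word_prod G s (Q n))"
  have R0: "?R [0..<n * n]"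
    unfolding reduced_positions_def map reduced_word_longest_iff[OF w] using w length_Q[of n] by simp
  have least: "[0..<n * n] = qs \<or> ([0..<n * n], qs) \<in> lexord less_than" if "?R qs" for qs
  proof -
    have "sorted_wrt (<) qs" "length qs = n * n"
      using that unfolding reduced_positions_def reduced_word_longest_iff[OF w] by auto
    then show ?thesis using strictly_sorted_lexord_least by metis
  qed
  have "(THE ps. ?R ps \<and> (\<forall>qs. ?R qs \<longrightarrow> ps = qs \<or> (ps, qs) \<in> lexord less_than)) = [0..<n * n]"
  proof (rule the_equality)
    fix ps assume ps: "?R ps \<and> (\<forall>qs. ?R qs \<longrightarrow> ps = qs \<or> (ps, qs) \<in> lexord less_than)"
    have "asym (lexord less_than)" by (intro lexord_asym asym_less_than)
    then show "ps = [0..<n * n]" using ps R0 least[of ps] by (metis asymD)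
  qed (use R0 least in blast)
  then show ?thesis unfolding sorting_word_def longest using map by (simp add: Q_def)
qed

theorem theorem2p10:
  fixes G :: "('a, 'b) monoid_scheme" and s :: "nat \<Rightarrow> 'a" and c :: 'a
    and cw :: "nat list" and k m :: nat
  assumes "m \<ge> k + 1"
    and "coxeter_system G {..<m - k} s coxeter_matrix_B"
    and "coxeter_element G {..<m - k} s c"
    and "reduced_word G {..<m - k} s cw c"
  shows "scomplex_iso (multi_cluster_complex G {..<m - k} s k cw)
           (symmetric_multitriangulation_complex m k)"
proof -
  define n where "n = m - k"
  have n: "0 < n" "n \<le> m" "m - n = k" "k + n = m" using assms(1) by (auto simp: n_def)
  interpret type_B_system G s n
    using assms(2) by unfold_locales (simp add: n_def)
  have cw: "coxeter_word n cw"
    using coxeter_word_if_reduced assms(3,4) by (simp add: n_def)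
  interpret coxeter_word n cw by (rule cw)
  have w: "Q n \<in> lists I" "perm_B (Q n) = opposite n" using Q_lists perm_B_Q by auto
  have Qm: "concat (replicate k cw) @ concat (replicate n cw) = Q m"
    using n(4) by (simp add: Q_def flip: concat_append replicate_add)
  have mcc: "multi_cluster_complex G I s k cw = subword_complex G I s (Q m) (word_prod G s (Q n))"
    unfolding multi_cluster_complex_def Let_def
      sorting_word_longest[OF cw, unfolded longest_element_eq[OF w]] Qm longest_element_eq[OF w] ..
  have face: "F \<in> snd (multi_cluster_complex G I s k cw) \<longleftrightarrow>
      position_pair m ` F \<in> snd (symmetric_multitriangulation_complex m k)" if F: "F \<subseteq> {..<n * m}" for F
  proof -
    have lists: "u \<in> lists I" if "subseq u (nths (Q m) (- F))" for u
    proof -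
      have "set u \<subseteq> set (nths (Q m) (- F))" using list_emb_set[OF that] by blast
      then show ?thesis using Q_lists[of m] set_nths_subset[of "Q m" "- F"] by auto
    qed
    have "F \<in> snd (multi_cluster_complex G I s k cw) \<longleftrightarrow>
        (\<exists>u. subseq u (nths (Q m) (- F)) \<and> length u = n * n \<and> perm_B u = opposite n)"
      unfolding mcc subword_complex_def reduced_word_longest_iff[OF w]
      using F lists by (auto simp: length_Q)
    also have "\<dots> \<longleftrightarrow> \<not> (\<exists>X\<subseteq>\<Union> (position_pair m ` F). is_crossing (k + 1) X)"
      unfolding Q_contains_opposite_iff[OF n(2)] Union_position_pair[OF F]
        is_crossing_iff_slot_chain[OF n(2)] n(3) by simp
    also have "\<dots> \<longleftrightarrow> position_pair m ` F \<in> snd (symmetric_multitriangulation_complex m k)"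
      using bij_betw_imp_surj_on[OF bij_position_pair[OF n(2,1)]] F n(3)
      by (auto simp: symmetric_multitriangulation_complex_def)
    finally show ?thesis .
  qed
  have "fst (multi_cluster_complex G I s k cw) = {..<n * m}"
    unfolding mcc by (simp add: subword_complex_def length_Q)
  moreover have "bij_betw (position_pair m) {..<n * m} (fst (symmetric_multitriangulation_complex m k))"
    using bij_position_pair[OF n(2,1)] n(3) by (simp add: symmetric_multitriangulation_complex_def)
  ultimately show ?thesis
    unfolding scomplex_iso_def n_def[symmetric] using face by auto
qed

end
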